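(* Consider the algorithm D--NG with step-size $\alpha_k=c/(k+1)$ on the problem of minimizing $f=\sum_{i=1}^N f_i$ over $\mathbb{R}^d$, where the weight matrix $W$ satisfies $\mu:=\mu(W)<1$ and $W\succeq\eta I$ with a fixed $\eta\in(0,1)$; $f$ has a minimizer $x^\star$, $f^\star=f(x^\star)$; every $f_i:\mathbb{R}^d\to\mathbb{R}$ is convex and differentiable with $L$-Lipschitz continuous gradient; $\|\nabla f_i(x)\|\le G$ for all $x$ and $i$; and $\|\overline{x}(0)-x^\star\|\le R$. Let $\xi\in(0,1)$ be arbitrary. Then, at every node $i$, $$\frac1N\left(f(x_i(k))-f^\star\right)=O\left(\frac{1}{(1-\mu)^{p+\xi}}\left[\frac{\log k}{k}+\frac{N^{1/2}\log^{1/2}k}{k^{3/2}}+\frac{N}{k^2}\right]\right),$$ where (a) $p=3$ for an arbitrary constant $c>0$ (independent of $N$ and $W$); (b) $p=1$ for $c=\frac{1-\mu(W)}{2L}$ (here $L>0$). Here the $O(\cdot)$ bound means: there is a finite constant depending only on $L,G,R,\eta,\xi$ (and, in case (a), on $c$), but not on $N$, the graph, $W$, or $k$, such that the left-hand side is at most this constant times the expression inside $O(\cdot)$, for all $k\ge 2$.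
   Context: Network: $N\ge 2$ nodes; $\mathcal{G}=(\mathcal{N},E)$ is a connected, undirected, simple graph on them. $W$ is a symmetric doubly stochastic $N\times N$ matrix with, for $i\ne j$, $W_{ij}>0$ if and only if $\{i,j\}\in E$. $O_i$ is the neighborhood of node $i$, including $i$ itself. $J=\frac1N\mathbf{1}\mathbf{1}^\top$, and $\mu(W)=\|W-J\|$ (spectral norm) is the second largest singular value of $W$. $\|\cdot\|$ is the Euclidean norm for vectors. Algorithm D--NG: each node $i$ holds $x_i(k),y_i(k)\in\mathbb{R}^d$, with common initialization $x_i(0)=y_i(0)=x_j(0)=y_j(0)$ for all $i,j$, and for $k=1,2,\dots$ $$x_i(k)=\sum_{j\in O_i}W_{ij}\,y_j(k-1)-\alpha_{k-1}\nabla f_i(y_i(k-1)),\qquad y_i(k)=x_i(k)+\beta_{k-1}\left(x_i(k)-x_i(k-1)\right),$$ with $\alpha_k=\frac{c}{k+1}$, $\beta_k=\frac{k}{k+3}$, $k=0,1,\dots$. Further $\overline{x}(k)=\frac1N\sum_{i=1}^N x_i(k)$. *)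

theory Defs
  imports "HOL-Analysis.Analysis" "Graph_Theory.Graph_Theory"
begin

text \<open>
  The constants in the convergence bounds must not depend on the number of nodes \<open>N\<close> or on the
  dimension \<open>d\<close>, so both are quantified inside the statement and cannot be type-level indices.
  All Euclidean spaces are therefore taken inside one inner product space, the finitely supported
  real sequences: \<open>euclid n\<close> below is \<open>n\<close>-dimensional Euclidean space with coordinates
  indexed by \<open>{..<n}\<close>.
\<close>

typedef fsvec = "{v :: nat \<Rightarrow> real. finite {i. v i \<noteq> 0}}"
  morphisms coord Abs_fsvec
  by (rule exI[of _ "\<lambda>_. 0"]) simp

setup_lifting type_definition_fsvec

lemma finite_coord [simp]: "finite {i. coord v i \<noteq> 0}"
  using coord[of v] by simp

lemma fsvec_eqI: "(\<And>i. coord u i = coord v i) \<Longrightarrow> u = v"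
  by (simp add: coord_inject[symmetric] fun_eq_iff)

instantiation fsvec :: real_vector
begin

lift_definition zero_fsvec :: fsvec is "\<lambda>_. 0" by simp

lift_definition plus_fsvec :: "fsvec \<Rightarrow> fsvec \<Rightarrow> fsvec" is "\<lambda>u v i. u i + v i"
  by (erule (1) finite_subset[OF _ finite_UnI, rotated]) auto

lift_definition uminus_fsvec :: "fsvec \<Rightarrow> fsvec" is "\<lambda>v i. - v i" by simp

lift_definition minus_fsvec :: "fsvec \<Rightarrow> fsvec \<Rightarrow> fsvec" is "\<lambda>u v i. u i - v i"
  by (erule (1) finite_subset[OF _ finite_UnI, rotated]) auto

lift_definition scaleR_fsvec :: "real \<Rightarrow> fsvec \<Rightarrow> fsvec" is "\<lambda>r v i. r * v i"
  by (erule finite_subset[rotated]) auto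

instance
  by standard (transfer; simp add: fun_eq_iff algebra_simps)+

end

lemma coord_simps [simp]:
  "coord 0 i = 0"
  "coord (u + v) i = coord u i + coord v i"
  "coord (- v) i = - coord v i"
  "coord (u - v) i = coord u i - coord v i"
  "coord (r *\<^sub>R v) i = r * coord v i"
  by (transfer; simp)+

lemma coord_sum [simp]: "coord (sum h A) i = (\<Sum>a\<in>A. coord (h a) i)"
  by (induction A rule: infinite_finite_induct) simp_all

instantiation fsvec :: real_inner
begin

definition inner_fsvec :: "fsvec \<Rightarrow> fsvec \<Rightarrow> real"
  where "inner_fsvec u v = (\<Sum>i | coord u i \<noteq> 0. coord u i * coord v i)"

definition norm_fsvec :: "fsvec \<Rightarrow> real"
  where "norm_fsvec v = sqrt (inner v v)"

definition dist_fsvec :: "fsvec \<Rightarrow> fsvec \<Rightarrow> real"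
  where "dist_fsvec u v = norm (u - v)"

definition sgn_fsvec :: "fsvec \<Rightarrow> fsvec"
  where "sgn_fsvec v = v /\<^sub>R norm v"

definition uniformity_fsvec :: "(fsvec \<times> fsvec) filter"
  where "uniformity_fsvec = (INF e\<in>{0<..}. principal {(u, v). dist u v < e})"

definition open_fsvec :: "fsvec set \<Rightarrow> bool"
  where "open_fsvec U \<longleftrightarrow> (\<forall>u\<in>U. \<forall>\<^sub>F (u', v) in uniformity. u' = u \<longrightarrow> v \<in> U)"

lemma inner_fsvec_superset:
  assumes "finite A" "{i. coord u i \<noteq> 0} \<subseteq> A"
  shows "inner u v = (\<Sum>i\<in>A. coord u i * coord v i)"
  unfolding inner_fsvec_def by (rule sum.mono_neutral_left) (use assms in auto)

instance
proof
  fix u v w :: fsvec and r :: real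
  let ?A = "{i. coord u i \<noteq> 0} \<union> {i. coord v i \<noteq> 0}"
  have A: "finite ?A" by simp
  show "inner u v = inner v u"
    by (subst (1 2) inner_fsvec_superset[OF A]) (auto simp: mult.commute)
  show "inner (u + v) w = inner u w + inner v w"
    by (subst (1 2 3) inner_fsvec_superset[OF A]) (auto simp: sum.distrib algebra_simps)
  show "inner (r *\<^sub>R u) v = r * inner u v"
    by (subst (1 2) inner_fsvec_superset[OF A]) (auto simp: sum_distrib_left algebra_simps)
  show "0 \<le> inner u u"
    by (simp add: inner_fsvec_def sum_nonneg)
  show "inner u u = 0 \<longleftrightarrow> u = 0"
    by (auto simp: inner_fsvec_def sum_nonneg_eq_0_iff intro: fsvec_eqI)
qed (simp_all add: norm_fsvec_def dist_fsvec_def sgn_fsvec_def uniformity_fsvec_def open_fsvec_def)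

end

definition euclid :: "nat \<Rightarrow> fsvec set"
  where "euclid n = {v. \<forall>i\<ge>n. coord v i = 0}"

lemma inner_euclid:
  assumes "u \<in> euclid n"
  shows "inner u v = (\<Sum>i<n. coord u i * coord v i)"
  by (rule inner_fsvec_superset) (use assms in \<open>force simp: euclid_def not_le[symmetric]\<close>)+

lemma subspace_euclid: "subspace (euclid n)"
  by (auto simp: subspace_def euclid_def)

text \<open>
  An \<open>n \<times> n\<close> matrix is a function on index pairs, of which only the entries with both indices
  below \<open>n\<close> count. As an operator it ignores all coordinates from \<open>n\<close> on, so that \<open>onorm\<close> of
  this operator is the spectral norm of the matrix.
\<close>

lift_definition mat_app :: "nat \<Rightarrow> (nat \<Rightarrow> nat \<Rightarrow> real) \<Rightarrow> fsvec \<Rightarrow> fsvec"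
  is "\<lambda>n A v i. if i < n then \<Sum>j<n. A i j * v j else 0"
  by (rule finite_subset[of _ "{..<_}"]) (auto split: if_splits)

definition spectral_norm :: "nat \<Rightarrow> (nat \<Rightarrow> nat \<Rightarrow> real) \<Rightarrow> real"
  where "spectral_norm n A = onorm (mat_app n A)"

definition mu :: "nat \<Rightarrow> (nat \<Rightarrow> nat \<Rightarrow> real) \<Rightarrow> real"
  where "mu N W = spectral_norm N (\<lambda>i j. W i j - 1 / real N)"

definition psd :: "nat \<Rightarrow> (nat \<Rightarrow> nat \<Rightarrow> real) \<Rightarrow> bool"
  where "psd n A \<longleftrightarrow> (\<forall>v\<in>euclid n. 0 \<le> inner v (mat_app n A v))"

definition doubly_stochastic :: "nat \<Rightarrow> (nat \<Rightarrow> nat \<Rightarrow> real) \<Rightarrow> bool"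
  where "doubly_stochastic n A \<longleftrightarrow>
    (\<forall>i<n. \<forall>j<n. 0 \<le> A i j) \<and> (\<forall>i<n. (\<Sum>j<n. A i j) = 1) \<and> (\<forall>j<n. (\<Sum>i<n. A i j) = 1)"

definition nbhd :: "nat pair_pre_digraph \<Rightarrow> nat \<Rightarrow> nat set"
  where "nbhd H i = insert i {j. (i, j) \<in> parcs H}"

definition gradient_on :: "fsvec set \<Rightarrow> (fsvec \<Rightarrow> real) \<Rightarrow> (fsvec \<Rightarrow> fsvec) \<Rightarrow> bool"
  where "gradient_on S h g \<longleftrightarrow>
    (\<forall>x\<in>S. g x \<in> S \<and> (h has_derivative (\<lambda>v. inner (g x) v)) (at x within S))"

definition objective :: "nat \<Rightarrow> (nat \<Rightarrow> fsvec \<Rightarrow> real) \<Rightarrow> fsvec \<Rightarrow> real"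
  where "objective N f z = (\<Sum>i<N. f i z)"

definition average :: "nat \<Rightarrow> (nat \<Rightarrow> fsvec) \<Rightarrow> fsvec"
  where "average N z = (1 / real N) *\<^sub>R (\<Sum>i<N. z i)"

definition step_size :: "real \<Rightarrow> nat \<Rightarrow> real"
  where "step_size c k = c / real (k + 1)"

definition momentum :: "nat \<Rightarrow> real"
  where "momentum k = real k / real (k + 3)"

text \<open>
  A run of D--NG. In \<open>x k i\<close> and \<open>y k i\<close> the first argument is the time and the second the node;
  \<open>g i\<close> is the gradient of \<open>f i\<close>. A \<open>pair_graph\<close> is a finite loop-free symmetric digraph
  without parallel arcs, i.e. a simple undirected graph. \<open>connected\<close> is qualified because of the
  topological notion of the same name.
\<close>

locale dng =
  fixes L G R \<eta> c :: real
    and N d :: nat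
    and H :: "nat pair_pre_digraph"
    and W :: "nat \<Rightarrow> nat \<Rightarrow> real"
    and f :: "nat \<Rightarrow> fsvec \<Rightarrow> real"
    and g :: "nat \<Rightarrow> fsvec \<Rightarrow> fsvec"
    and xstar :: fsvec
    and x y :: "nat \<Rightarrow> nat \<Rightarrow> fsvec"
  assumes nodes: "N \<ge> 2"
    and dim: "d \<ge> 1"
    and graph: "pair_graph H" "pverts H = {..<N}" "Digraph_Component.connected (with_proj H)"
    and weights_symmetric: "\<And>i j. i < N \<Longrightarrow> j < N \<Longrightarrow> W i j = W j i"
    and weights_stochastic: "doubly_stochastic N W"
    and weights_graph: "\<And>i j. i < N \<Longrightarrow> j < N \<Longrightarrow> i \<noteq> j \<Longrightarrow> W i j > 0 \<longleftrightarrow> (i, j) \<in> parcs H"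
    and mu_less_1: "mu N W < 1"
    and weights_lower: "psd N (\<lambda>i j. W i j - \<eta> * (if i = j then 1 else 0))"
    and convex: "\<And>i. i < N \<Longrightarrow> convex_on (euclid d) (f i)"
    and gradient: "\<And>i. i < N \<Longrightarrow> gradient_on (euclid d) (f i) (g i)"
    and gradient_lipschitz: "\<And>i. i < N \<Longrightarrow> L-lipschitz_on (euclid d) (g i)"
    and gradient_bounded: "\<And>i z. i < N \<Longrightarrow> z \<in> euclid d \<Longrightarrow> norm (g i z) \<le> G"
    and minimizer: "is_arg_min (objective N f) (\<lambda>z. z \<in> euclid d) xstar"
    and initial_euclid: "\<And>i. i < N \<Longrightarrow> x 0 i \<in> euclid d"
    and initial_common: "\<And>i j. i < N \<Longrightarrow> j < N \<Longrightarrow> x 0 i = x 0 j"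
    and initial_y: "\<And>i. i < N \<Longrightarrow> y 0 i = x 0 i"
    and initial_dist: "norm (average N (x 0) - xstar) \<le> R"
    and x_step: "\<And>k i. i < N \<Longrightarrow>
      x (Suc k) i = (\<Sum>j\<in>nbhd H i. W i j *\<^sub>R y k j) - step_size c k *\<^sub>R g i (y k i)"
    and y_step: "\<And>k i. i < N \<Longrightarrow>
      y (Suc k) i = x (Suc k) i + momentum k *\<^sub>R (x (Suc k) i - x k i)"

definition rate :: "real \<Rightarrow> real \<Rightarrow> nat \<Rightarrow> nat \<Rightarrow> real"
  where "rate q \<mu> N k = 1 / (1 - \<mu>) powr q *
    (ln (real k) / real k
      + sqrt (real N) * sqrt (ln (real k)) / real k powr (3 / 2)
      + real N / (real k)\<^sup>2)"

end

theory Submission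
  imports Defs
begin

text \<open>
  Consensus: on stacked vectors with mean zero, \<open>T = W\<close> is a psd contraction of norm at most \<open>\<mu>\<close>.
  The quadratic form \<open>Q(a, b) = |a|^2 - 2 <T a, b> + <T b, b>\<close> satisfies
  \<open>Q(T (a + \<beta> (a - b)), a) \<le> \<mu> Q(a, b)\<close> for every momentum \<open>\<beta>\<close> in \<open>[0, 1]\<close>, and
  \<open>(1 - \<mu>) |a|^2 \<le> Q(a, b)\<close>. A perturbation \<open>p\<close> of the first argument raises \<open>sqrt Q\<close> by at most
  \<open>|p|\<close>, so \<open>q k = sqrt (Q(x (k + 1), x k))\<close> obeys
  \<open>q (k + 1) \<le> sqrt \<mu> q k + c sqrt N G / (k + 2)\<close>, hence
  \<open>q k = O(c sqrt N G (1 - \<mu>)^(-1-\<xi>/2) / (k + 1))\<close>. The squared distance of the nodes from their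
  average is thus \<open>O(N c^2 G^2 (1 - \<mu>)^(-3-\<xi>) / k^2)\<close>.

  Optimality: the averages perform Nesterov's method on \<open>f / N\<close> with a gradient oracle whose error
  at step \<open>k\<close> is \<open>O(L c^2 G^2 (1 - \<mu>)^(-3-\<xi>) / (k + 1)^2)\<close>. Steps longer than \<open>1 / L\<close> only add an
  error of the same order, since the gradients are bounded. Weighted by \<open>k\<close>, these errors sum to a
  logarithm. For \<open>c = (1 - \<mu>) / (2 L)\<close>, the factor \<open>c^2\<close> cancels \<open>(1 - \<mu>)^2\<close>.
\<close>

section \<open>Energy of the momentum iteration under a positive semidefinite contraction\<close>

text \<open>The assumptions are confined to \<open>S\<close> because \<open>W\<close> fixes the
  constant vectors and can contract only on their orthogonal complement.\<close>

locale psd_contraction =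
  fixes S :: "'a::real_inner set" and T :: "'a \<Rightarrow> 'a" and \<mu> :: real
  assumes subspace: "subspace S"
    and linear: "linear T"
    and maps_to: "u \<in> S \<Longrightarrow> T u \<in> S"
    and selfadjoint: "u \<in> S \<Longrightarrow> v \<in> S \<Longrightarrow> inner (T u) v = inner u (T v)"
    and nonneg: "u \<in> S \<Longrightarrow> 0 \<le> inner (T u) u"
    and norm_le: "u \<in> S \<Longrightarrow> norm (T u) \<le> \<mu> * norm u"
    and mu_bounds: "0 \<le> \<mu>" "\<mu> < 1"
begin

definition energy :: "'a \<Rightarrow> 'a \<Rightarrow> real"
  where "energy a b = (norm a)\<^sup>2 - 2 * inner (T a) b + inner (T b) b"

lemma quadratic_form_le: "u \<in> S \<Longrightarrow> inner (T u) u \<le> \<mu> * (norm u)\<^sup>2"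
  using norm_cauchy_schwarz[of "T u" u] mult_right_mono[OF norm_le norm_ge_zero, of u u]
  by (simp add: power2_eq_square)

lemmas T_simps = linear_add[OF linear] linear_diff[OF linear] linear_scale[OF linear]

lemma norm_square_le:
  assumes u: "u \<in> S"
  shows "(norm (T u))\<^sup>2 \<le> \<mu> * inner (T u) u"
\<comment> \<open>The identity below carries a factor \<open>\<mu>\<close> that is cancelled at the
  end; \<open>\<mu> = 0\<close> forces \<open>T u = 0\<close>.\<close>
proof (cases "\<mu> = 0")
  case True
  then show ?thesis using norm_le[OF u] by simp
next
  case False
  then have pos: "\<mu> > 0" using mu_bounds by simp
  define w where "w = \<mu> *\<^sub>R u - T u"
  have Tu: "T u \<in> S" and w: "w \<in> S"
    using maps_to[OF u] subspace_diff[OF subspace] subspace_scale[OF subspace] u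
    by (auto simp: w_def)
  \<comment> \<open>\<open>\<mu> T (\<mu> - T) = T (\<mu> - T) T + (\<mu> - T) T (\<mu> - T)\<close>, a sum of two nonnegative forms\<close>
  have "\<mu> * (\<mu> * inner (T u) u - (norm (T u))\<^sup>2)
      = (\<mu> * (norm (T u))\<^sup>2 - inner (T (T u)) (T u)) + inner (T w) w"
    using selfadjoint[OF Tu u]
    by (simp add: w_def T_simps inner_diff_left inner_diff_right power2_norm_eq_inner inner_commute algebra_simps)
  also have "\<dots> \<ge> 0"
    using quadratic_form_le[OF Tu] nonneg[OF w] by simp
  finally show ?thesis using pos by (simp add: zero_le_mult_iff)
qed

text \<open>Separates momentum from position: both summands are nonnegative forms, of
  \<open>T\<close> at \<open>a - b\<close> and of \<open>1 - T\<close> at \<open>a\<close>.\<close>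

lemma energy_eq:
  assumes "a \<in> S" "b \<in> S"
  shows "energy a b = inner (T (a - b)) (a - b) + ((norm a)\<^sup>2 - inner (T a) a)"
  using selfadjoint[OF assms] 
  by (simp add: energy_def T_simps inner_diff_left inner_diff_right inner_commute)

text \<open>Completes the square in \<open>a\<close>: the minimum is at \<open>T b\<close>, the
  iterate without momentum, and the remainder is the form of \<open>T (1 - T)\<close> at
  \<open>b\<close>.\<close>

lemma energy_eq_residual:
  assumes "a \<in> S" "b \<in> S"
  shows "energy a b = (norm (a - T b))\<^sup>2 + (inner (T b) b - (norm (T b))\<^sup>2)"
  using selfadjoint[OF assms] 
  by (simp add: energy_def power2_norm_eq_inner inner_diff_left inner_diff_right inner_commute)

lemma energy_ge:
  assumes "a \<in> S" "b \<in> S"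
  shows "(1 - \<mu>) * (norm a)\<^sup>2 \<le> energy a b"
  using quadratic_form_le[OF assms(1)] nonneg[OF subspace_diff[OF subspace assms]]
  by (simp add: energy_eq[OF assms] algebra_simps)

lemma energy_nonneg: "a \<in> S \<Longrightarrow> b \<in> S \<Longrightarrow> 0 \<le> energy a b"
  using energy_ge[of a b] mu_bounds by (meson diff_ge_0_iff_ge less_imp_le order_trans zero_le_mult_iff zero_le_power2)

lemma energy_zero: "energy a 0 = (norm a)\<^sup>2"
  using linear_0[OF linear] by (simp add: energy_def)

text \<open>The new iterate differs from \<open>T a\<close> by \<open>\<beta> T (a - b)\<close>, so
  its energy splits into a momentum term and the form of \<open>T (1 - T)\<close> at
  \<open>a\<close>. Each is at most \<open>\<mu>\<close> times the matching summand in
  \<open>energy_eq\<close>.\<close>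

lemma energy_momentum_step:
  assumes a: "a \<in> S" and b: "b \<in> S" and \<beta>: "0 \<le> \<beta>" "\<beta> \<le> 1"
  shows "energy (T (a + \<beta> *\<^sub>R (a - b))) a \<le> \<mu> * energy a b"
proof -
  have ab: "a - b \<in> S" by (rule subspace_diff[OF subspace a b])
  have m: "T (a + \<beta> *\<^sub>R (a - b)) \<in> S"
    by (intro maps_to subspace_add[OF subspace] subspace_scale[OF subspace] a ab)
  have "energy (T (a + \<beta> *\<^sub>R (a - b))) a
      = \<beta>\<^sup>2 * (norm (T (a - b)))\<^sup>2 + (inner (T a) a - (norm (T a))\<^sup>2)"
    unfolding energy_eq_residual[OF m a]
    by (simp add: linear_add[OF linear] linear_scale[OF linear] power_mult_distrib)
  also have "\<beta>\<^sup>2 * (norm (T (a - b)))\<^sup>2 \<le> 1 * (norm (T (a - b)))\<^sup>2"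
    using \<beta> by (intro mult_right_mono power_le_one) auto
  also have "\<dots> \<le> \<mu> * inner (T (a - b)) (a - b)"
    using norm_square_le[OF ab] by simp
  \<comment> \<open>\<open>\<mu> (1 - T) - T (1 - T) = (\<mu> - T)^2 + (1 - \<mu>) (\<mu> -
    T)\<close>, and both terms on the right are nonnegative forms.\<close>
  also have "inner (T a) a - (norm (T a))\<^sup>2 \<le> \<mu> * ((norm a)\<^sup>2 - inner (T a) a)"
  proof -
    have "0 \<le> (norm (\<mu> *\<^sub>R a - T a))\<^sup>2 + (1 - \<mu>) * (\<mu> * (norm a)\<^sup>2 - inner (T a) a)"
      using quadratic_form_le[OF a] mu_bounds by (intro add_nonneg_nonneg mult_nonneg_nonneg) auto
    also have "\<dots> = \<mu> * ((norm a)\<^sup>2 - inner (T a) a) - (inner (T a) a - (norm (T a))\<^sup>2)"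
      by (simp add: power2_norm_eq_inner inner_diff_left inner_diff_right inner_commute algebra_simps)
    finally show ?thesis by simp
  qed
  finally show ?thesis by (simp add: energy_eq[OF a b] algebra_simps)
qed

text \<open>As a function of \<open>a\<close>, the energy is the squared distance to
  \<open>T b\<close> plus a nonnegative constant, so its square root is 1-Lipschitz.\<close>

lemma sqrt_energy_add_le:
  assumes a: "a \<in> S" and b: "b \<in> S" and p: "p \<in> S"
  shows "sqrt (energy (a + p) b) \<le> sqrt (energy a b) + norm p"
proof (rule real_le_lsqrt)
  have "(norm (T b))\<^sup>2 \<le> inner (T b) b"
  proof -
    have "\<mu> * inner (T b) b \<le> 1 * inner (T b) b"
      using mu_bounds nonneg[OF b] by (intro mult_right_mono) auto
    then show ?thesis using norm_square_le[OF b] by simp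
  qed
  then have "(norm (a - T b))\<^sup>2 \<le> energy a b"
    by (simp add: energy_eq_residual[OF a b])
  then have le: "norm (a - T b) \<le> sqrt (energy a b)"
    by (rule real_le_rsqrt)
  have "energy (a + p) b = energy a b + 2 * inner p (a - T b) + (norm p)\<^sup>2"
    using selfadjoint[OF p b]
    by (simp add: energy_def T_simps power2_norm_eq_inner algebra_simps inner_commute)
  also have "inner p (a - T b) \<le> norm p * sqrt (energy a b)"
    using norm_cauchy_schwarz[of p "a - T b"] mult_left_mono[OF le norm_ge_zero[of p]] by linarith
  finally show "energy (a + p) b \<le> (sqrt (energy a b) + norm p)\<^sup>2"
    using energy_nonneg[OF a b] by (simp add: power2_sum algebra_simps)
qed (use energy_nonneg[OF a b] in simp)

end

section \<open>Logarithms and a perturbed scalar contraction\<close>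

text \<open>Trades the logarithm of a harmonic sum for a small power; the exponent loss
  \<open>\<xi>\<close> originates here.\<close>

lemma one_plus_ln_le:
  fixes k :: nat
  assumes k: "k \<ge> 1" and s: "0 < s"
  shows "1 + ln (real k) \<le> (1 + 1 / s) * real k powr s"
proof -
  have "1 \<le> real k powr s" using k s by (simp add: ge_one_powr_ge_zero)
  moreover have "ln (real k) \<le> real k powr s / s" using k s by (intro ln_powr_bound) auto
  ultimately show ?thesis by (simp add: algebra_simps)
qed

lemma inverse_Suc_le_ln_diff: "1 / real (k + 2) \<le> ln (real (k + 2)) - ln (real (k + 1))"
proof -
  have "ln (real (k + 1) / real (k + 2)) \<le> real (k + 1) / real (k + 2) - 1"
    by (rule ln_le_minus_one) simp
  also have "\<dots> = - (1 / real (k + 2))" by (simp add: field_simps)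
  finally show ?thesis by (simp add: ln_div)
qed

lemma sum_inverse_le_ln: "(\<Sum>j<Suc k. 1 / real (j + 1)) \<le> 1 + ln (real (k + 1))"
proof (induction k)
  case (Suc k)
  then show ?case using inverse_Suc_le_ln_diff[of k] by (simp add: add.commute)
qed simp

text \<open>Geometric decay convolved with a harmonic perturbation decays harmonically, at the cost
  of about one factor \<open>1 / (1 - r)\<close>. The extra exponent \<open>s\<close> pays for the
  logarithm accumulated before the contraction becomes effective.\<close>

lemma recursion_bound:
  fixes q :: "nat \<Rightarrow> real"
  assumes r: "0 \<le> r" "r < 1" and s: "0 < s" "s \<le> 1" and e: "0 \<le> e"
    and q0: "q 0 \<le> e"
    and step: "\<And>k. q (Suc k) \<le> r * q k + e / real (k + 2)"
    and nonneg: "\<And>k. 0 \<le> q k"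
  shows "real (k + 1) * q k \<le> e * ((1 + 1 / s) * (3 / (1 - r)) powr (1 + s))"
proof -
  define \<delta> where "\<delta> = 1 - r"
  \<comment> \<open>\<open>B\<close> must dominate \<open>k (1 + ln k)\<close> up to
    \<open>k = 3 / \<delta>\<close>, and also \<open>3 / \<delta>\<close> itself, so that
    \<open>\<delta> / 2 * B \<ge> 1\<close>.\<close>
  define B where "B = (1 + 1 / s) * (3 / \<delta>) powr (1 + s)"
  have \<delta>: "0 < \<delta>" "\<delta> \<le> 1" using r by (auto simp: \<delta>_def)
  have B3: "3 / \<delta> \<le> B"
  proof -
    have "(3 / \<delta>) powr 1 \<le> (3 / \<delta>) powr (1 + s)"
      using \<delta> s by (intro powr_mono) auto
    also have "\<dots> \<le> B" using s unfolding B_def by (simp add: algebra_simps)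
    finally show ?thesis using \<delta> by simp
  qed
  have "1 \<le> 3 / \<delta>" using \<delta> by simp
  then have B1: "1 \<le> B" using B3 by linarith
  have small: "q k \<le> e * (1 + ln (real (k + 1)))" for k
  proof (induction k)
    case (Suc k)
    have "q (Suc k) \<le> 1 * q k + e / real (k + 2)"
      using step[of k] mult_right_mono[of r 1 "q k"] r nonneg[of k] by linarith
    also have "\<dots> \<le> e * (1 + ln (real (k + 1))) + e * (1 / real (k + 2))"
      using Suc by simp
    also have "\<dots> \<le> e * (1 + ln (real (k + 2)))"
      using mult_left_mono[OF inverse_Suc_le_ln_diff e, of k] by (simp only: algebra_simps)
    finally show ?case by (simp add: add.commute)
  qed (use q0 in simp)
  have "real (k + 1) * q k \<le> e * B"
  proof (induction k)
    case 0
    show ?case using q0 mult_left_mono[OF B1 e] by simp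
  next
    case (Suc k)
    show ?case
    \<comment> \<open>up to time \<open>3 / \<delta>\<close> the harmonic growth of \<open>q\<close> suffices; later the contraction takes over\<close>
    proof (cases "\<delta> * real (k + 2) \<le> 3")
      case True
      then have k3: "real (k + 2) \<le> 3 / \<delta>" using \<delta> by (simp add: field_simps)
      have "1 + ln (real (k + 2)) \<le> (1 + 1 / s) * real (k + 2) powr s"
        by (rule one_plus_ln_le) (use s in auto)
      then have "real (k + 2) * (1 + ln (real (k + 2)))
          \<le> real (k + 2) * ((1 + 1 / s) * real (k + 2) powr s)"
        by (rule mult_left_mono) simp
      also have "\<dots> = (1 + 1 / s) * real (k + 2) powr (1 + s)"
        by (simp add: powr_add)
      also have "\<dots> \<le> B"
        unfolding B_def using s k3 by (intro mult_left_mono powr_mono2) auto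
      finally have "e * (real (k + 2) * (1 + ln (real (k + 2)))) \<le> e * B"
        by (rule mult_left_mono[OF _ e])
      moreover have "real (k + 2) * q (Suc k) \<le> real (k + 2) * (e * (1 + ln (real (k + 2))))"
        using small[of "Suc k"] by (intro mult_left_mono) (simp_all add: add.commute)
      ultimately show ?thesis by (simp add: algebra_simps)
    next
      case False
      \<comment> \<open>Now \<open>(k + 2) / (k + 1) \<le> 1 + \<delta> / 2\<close>, so rescaling by
        time weakens the factor \<open>1 - \<delta>\<close> only to \<open>1 - \<delta> / 2\<close>;
        the gain \<open>\<delta> / 2 * e * B\<close> absorbs the new \<open>e\<close>.\<close>
      then have "2 \<le> \<delta> * real (k + 1)" using \<delta> by (simp add: algebra_simps)
      then have k2: "1 / real (k + 1) \<le> \<delta> / 2" by (simp add: field_simps)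
      have "real (k + 2) * q (Suc k) \<le> real (k + 2) * (r * q k + e / real (k + 2))"
        by (rule mult_left_mono[OF step]) simp
      also have "\<dots> = r * (1 + 1 / real (k + 1)) * (real (k + 1) * q k) + e"
        by (simp add: field_simps)
      also have "\<dots> \<le> r * (1 + \<delta> / 2) * (e * B) + e"
        using Suc k2 r nonneg[of k] \<delta>
        by (intro add_right_mono mult_mono[where b = "r * (1 + \<delta> / 2)"] mult_left_mono add_left_mono) auto
      also have "r * (1 + \<delta> / 2) = 1 - \<delta> / 2 - \<delta>\<^sup>2 / 2"
        by (simp add: \<delta>_def power2_eq_square field_simps)
      also have "\<dots> * (e * B) \<le> (1 - \<delta> / 2) * (e * B)"
        using e B1 by (intro mult_right_mono) auto
      finally have "real (k + 2) * q (Suc k) \<le> (1 - \<delta> / 2) * (e * B) + e" by simp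
      moreover have "e * 1 \<le> e * (\<delta> / 2 * B)"
        using B3 \<delta> by (intro mult_left_mono e) (simp add: field_simps)
      ultimately show ?thesis by (simp add: algebra_simps)
    qed
  qed
  then show ?thesis by (simp add: B_def \<delta>_def)
qed

section \<open>Nesterov's method with an inexact oracle\<close>

text \<open>The hypothesis \<open>step\<close> is a gradient-step inequality at an arbitrary
  comparison point \<open>u\<close>. Taking \<open>u\<close> between \<open>x k\<close> and
  \<open>z\<close> turns both distances into multiples of \<open>v - z\<close>, and
  \<open>A k * gap (Suc k) + V (Suc k)\<close> becomes a Lyapunov function up to the errors.\<close>

lemma inexact_nesterov:
  fixes x y :: "nat \<Rightarrow> 'a::real_inner" and h :: "'a \<Rightarrow> real"
  assumes S: "subspace S" "\<And>k. x k \<in> S" "z \<in> S"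
    and h: "convex_on S h" "\<And>u. u \<in> S \<Longrightarrow> h z \<le> h u"
    and c: "c > 0"
    and y0: "y 0 = x 0"
    and y: "\<And>k. y (Suc k) = x (Suc k) + momentum k *\<^sub>R (x (Suc k) - x k)"
    and step: "\<And>k u. u \<in> S \<Longrightarrow> h (x (Suc k)) \<le> h u
      + ((norm (y k - u))\<^sup>2 - (norm (x (Suc k) - u))\<^sup>2) / (2 * step_size c k) + E / (real (k + 1))\<^sup>2"
    and E: "E \<ge> 0"
  shows "h (x (Suc k)) - h z
      \<le> 2 / (c * real (k + 1)) * ((norm (x 0 - z))\<^sup>2 + 2 * c * E * (1 + ln (real (k + 1))))"
proof -
  note mem = subspace_add[OF S(1)] subspace_diff[OF S(1)] subspace_scale[OF S(1)]
  \<comment> \<open>\<open>y k = (1 - t) *\<^sub>R x k + t *\<^sub>R v k\<close> for \<open>t = 2 / (k + 2)\<close>\<close>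
  define v where "v k = (case k of 0 \<Rightarrow> x 0
    | Suc j \<Rightarrow> (1 / 2) *\<^sub>R (real (j + 2) *\<^sub>R x (Suc j) - real j *\<^sub>R x j))" for k
  \<comment> \<open>\<open>A k = 2 * step_size c k / t^2\<close> is the weight that frees
    \<open>V\<close> of its factor.\<close>
  define A where "A k = c * (real (k + 2))\<^sup>2 / (2 * real (k + 1))" for k
  define gap where "gap k = h (x k) - h z" for k
  define V where "V k = (norm (v k - z))\<^sup>2" for k
  have gap: "0 \<le> gap k" for k using h(2) S(2) by (simp add: gap_def)
  have A_pos: "A k > 0" for k using c by (simp add: A_def)
  have descent: "A k * gap (Suc k) + V (Suc k)
      \<le> A k * (real k / real (k + 2)) * gap k + V k + 2 * c * E / real (k + 1)" for k
  proof -
    define t where "t = 2 / real (k + 2)"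
    define u where "u = (1 - t) *\<^sub>R x k + t *\<^sub>R z"
    have t: "0 \<le> t" "t \<le> 1" "1 - t = real k / real (k + 2)" by (auto simp: t_def field_simps)
    have kt: "real (k + 2) * t = 2" "real (k + 2) * (1 - t) = real k"
      by (simp_all add: t_def field_simps)
    have u: "u \<in> S" unfolding u_def by (intro mem S)
    have hu: "h u \<le> (1 - t) * h (x k) + t * h z"
      unfolding u_def by (rule convex_onD[OF h(1)]) (use t S in auto)
    have xu: "x (Suc k) - u = t *\<^sub>R (v (Suc k) - z)"
    proof -
      have "real (k + 2) *\<^sub>R (x (Suc k) - u) = real (k + 2) *\<^sub>R x (Suc k)
          - (real (k + 2) * (1 - t)) *\<^sub>R x k - (real (k + 2) * t) *\<^sub>R z"
        by (simp only: u_def scaleR_right_diff_distrib scaleR_right_distrib scaleR_scaleR) simp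
      also have "\<dots> = (real (k + 2) * t) *\<^sub>R (v (Suc k) - z)"
        unfolding kt by (simp add: v_def algebra_simps)
      finally have "real (k + 2) *\<^sub>R (x (Suc k) - u) = real (k + 2) *\<^sub>R (t *\<^sub>R (v (Suc k) - z))"
        by (simp only: scaleR_scaleR)
      then show ?thesis by (simp only: scaleR_cancel_left) simp
    qed
    have yu: "y k - u = t *\<^sub>R (v k - z)"
    proof (cases k)
      case 0
      then show ?thesis using y0 by (simp add: u_def t_def v_def)
    next
      case (Suc j)
      \<comment> \<open>For \<open>k = j + 1\<close> the denominator of \<open>momentum j\<close> is
        exactly \<open>k + 2\<close>; here the choice \<open>j / (j + 3)\<close> matters.\<close>
      have kb: "real (k + 2) * momentum j = real j" by (simp add: Suc momentum_def) (simp add: add.commute)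
      have "real (k + 2) *\<^sub>R (y k - u) = real (k + 2) *\<^sub>R x k
          + (real (k + 2) * momentum j) *\<^sub>R (x k - x j)
          - (real (k + 2) * (1 - t)) *\<^sub>R x k - (real (k + 2) * t) *\<^sub>R z"
        using y[of j, folded Suc]
        by (simp only: u_def scaleR_right_diff_distrib scaleR_right_distrib scaleR_scaleR) simp
      also have "\<dots> = (real (k + 2) * t) *\<^sub>R (v k - z)"
        unfolding kt kb using scaleR_left_distrib[of 1 2 "x (Suc j)"]
        by (simp add: v_def Suc algebra_simps)
      finally have "real (k + 2) *\<^sub>R (y k - u) = real (k + 2) *\<^sub>R (t *\<^sub>R (v k - z))"
        by (simp only: scaleR_scaleR)
      then show ?thesis by (simp only: scaleR_cancel_left) simp
    qed
    have "(2 / b)\<^sup>2 / (2 * (c / a)) = 1 / (c * b\<^sup>2 / (2 * a))" if "a > 0" "b > 0" for a b :: real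
      using that c by (simp add: power2_eq_square field_simps)
    then have "t\<^sup>2 / (2 * step_size c k) = 1 / A k"
      unfolding t_def step_size_def A_def by simp
    then have "((norm (y k - u))\<^sup>2 - (norm (x (Suc k) - u))\<^sup>2) / (2 * step_size c k)
        = (V k - V (Suc k)) / A k"
      unfolding xu yu V_def
      by (simp add: power_mult_distrib flip: right_diff_distrib times_divide_eq_left)
         (metis (no_types, lifting) mult.commute times_divide_eq_left times_divide_eq_right mult_1)
    then have "gap (Suc k) \<le> (1 - t) * gap k + (V k - V (Suc k)) / A k + E / (real (k + 1))\<^sup>2"
      using step[OF u, of k] hu by (simp add: gap_def algebra_simps)
    then have "A k * gap (Suc k) \<le> A k * ((1 - t) * gap k + (V k - V (Suc k)) / A k + E / (real (k + 1))\<^sup>2)"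
      using A_pos[of k] by (simp add: mult_left_mono)
    also have "\<dots> = A k * (1 - t) * gap k + (V k - V (Suc k)) + A k * (E / (real (k + 1))\<^sup>2)"
      using A_pos[of k] by (simp add: distrib_left mult.assoc)
    \<comment> \<open>\<open>A k\<close> grows linearly, so errors of order \<open>1 / k^2\<close>
      are weighted to order \<open>1 / k\<close>; their sum is the logarithm in the bound.\<close>
    also have "A k * (E / (real (k + 1))\<^sup>2) \<le> 2 * c * E / real (k + 1)"
    proof -
      have "(real (k + 2))\<^sup>2 \<le> (2 * real (k + 1))\<^sup>2" by (intro power_mono) auto
      then have "A k \<le> c * (2 * real (k + 1))\<^sup>2 / (2 * real (k + 1))"
        unfolding A_def using c by (intro divide_right_mono mult_left_mono) auto
      also have "\<dots> = 2 * c * real (k + 1)" by (simp add: power2_eq_square)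
      finally have "A k \<le> 2 * c * real (k + 1)" .
      then have "A k * (E / (real (k + 1))\<^sup>2) \<le> 2 * c * real (k + 1) * (E / (real (k + 1))\<^sup>2)"
        using E by (intro mult_right_mono) auto
      then show ?thesis by (simp add: power2_eq_square)
    qed
    finally show ?thesis by (simp add: t(3))
  qed
  have "A k * gap (Suc k) + V (Suc k) \<le> V 0 + 2 * c * E * (\<Sum>j<Suc k. 1 / real (j + 1))" for k
  proof (induction k)
    \<comment> \<open>The coefficient of \<open>gap 0\<close> in \<open>descent\<close> is zero, so
      the initial value of \<open>h\<close> does not enter the bound.\<close>
    case 0
    show ?case using descent[of 0] by simp
  next
    case (Suc k)
    \<comment> \<open>The next step charges \<open>gap (Suc k)\<close> no more than the weight
      already earned: after clearing denominators,
      \<open>(k + 1)^2 (k + 3) \<le> (k + 2)^3\<close>.\<close>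
    have "A (Suc k) * (real (Suc k) / real (Suc k + 2)) \<le> A k"
    proof -
      have "(real k + 1)\<^sup>2 * (real k + 3) \<le> (real k + 2) ^ 3"
        by (simp add: power2_eq_square power3_eq_cube algebra_simps)
      then show ?thesis
        using c by (simp add: A_def divide_simps power2_eq_square power3_eq_cube) (simp add: algebra_simps)
    qed
    then have "A (Suc k) * (real (Suc k) / real (Suc k + 2)) * gap (Suc k) \<le> A k * gap (Suc k)"
      by (rule mult_right_mono[OF _ gap])
    then show ?case using descent[of "Suc k"] Suc by (simp add: algebra_simps)
  qed
  from this[of k] have "A k * gap (Suc k) \<le> V 0 + 2 * c * E * (\<Sum>j<Suc k. 1 / real (j + 1))"
    by (smt (verit) V_def zero_le_power2)
  also have "\<dots> \<le> V 0 + 2 * c * E * (1 + ln (real (k + 1)))"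
    using c E by (intro add_left_mono mult_left_mono sum_inverse_le_ln) auto
  finally have *: "A k * gap (Suc k) \<le> V 0 + 2 * c * E * (1 + ln (real (k + 1)))" .
  have "c * real (k + 1) / 2 \<le> A k"
    using c by (simp add: A_def divide_simps power2_eq_square) (simp add: algebra_simps)
  then have le: "c * real (k + 1) / 2 * gap (Suc k) \<le> V 0 + 2 * c * E * (1 + ln (real (k + 1)))"
    using mult_right_mono[OF _ gap] * by (meson order_trans)
  have "t \<le> 2 / p * r" if "0 < p" "p / 2 * t \<le> r" for p r t :: real
    using that by (simp add: field_simps)
  from this[OF _ le] have "gap (Suc k)
      \<le> 2 / (c * real (k + 1)) * (V 0 + 2 * c * E * (1 + ln (real (k + 1))))"
    using c by simp
  then show ?thesis by (simp add: gap_def V_def v_def)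
qed

section \<open>Matrices as operators, and stacked node vectors\<close>

lemma coord_mat_app: "coord (mat_app n A v) i = (if i < n then \<Sum>j<n. A i j * coord v j else 0)"
  by transfer simp

lemma linear_mat_app: "linear (mat_app n A)"
  by (rule linearI; rule fsvec_eqI)
     (auto simp: coord_mat_app sum.distrib sum_distrib_left algebra_simps)

lemma mat_app_euclid: "mat_app n A v \<in> euclid n"
  by (simp add: euclid_def coord_mat_app)

lemma norm_euclid: "v \<in> euclid n \<Longrightarrow> norm v = L2_set (coord v) {..<n}"
  by (simp add: norm_eq_sqrt_inner inner_euclid L2_set_def power2_eq_square)

lemma abs_coord_le_norm: "\<bar>coord v i\<bar> \<le> norm v"
proof -
  have "(coord v i)\<^sup>2 \<le> (\<Sum>j\<in>insert i {j. coord v j \<noteq> 0}. (coord v j)\<^sup>2)"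
    by (rule member_le_sum) auto
  also have "\<dots> = inner v v"
    by (subst inner_fsvec_superset[of "insert i {j. coord v j \<noteq> 0}"]) (auto simp: power2_eq_square)
  finally show ?thesis
    by (simp add: norm_eq_sqrt_inner real_le_rsqrt)
qed

lemma bounded_linear_mat_app: "bounded_linear (mat_app n A)"
proof (unfold bounded_linear_def bounded_linear_axioms_def)
  have "norm (mat_app n A v) \<le> norm v * (\<Sum>i<n. \<Sum>j<n. \<bar>A i j\<bar>)" for v
  proof -
    have "norm (mat_app n A v) \<le> (\<Sum>i<n. \<bar>coord (mat_app n A v) i\<bar>)"
      unfolding norm_euclid[OF mat_app_euclid] by (rule L2_set_le_sum_abs)
    also have "\<dots> \<le> (\<Sum>i<n. \<Sum>j<n. \<bar>A i j\<bar> * norm v)"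
      by (intro sum_mono)
         (auto simp: coord_mat_app abs_mult abs_coord_le_norm intro!: order_trans[OF sum_abs] sum_mono mult_left_mono)
    finally show ?thesis by (simp add: sum_distrib_left mult.commute)
  qed
  then show "linear (mat_app n A) \<and> (\<exists>K. \<forall>v. norm (mat_app n A v) \<le> norm v * K)"
    using linear_mat_app by blast
qed

lemma mat_app_selfadjoint:
  assumes "\<And>i j. i < n \<Longrightarrow> j < n \<Longrightarrow> A i j = A j i" and v: "v \<in> euclid n"
  shows "inner (mat_app n A u) v = inner u (mat_app n A v)"
proof -
  have "inner (mat_app n A u) v = (\<Sum>i<n. \<Sum>j<n. A i j * coord u j * coord v i)"
    by (simp add: inner_euclid[OF mat_app_euclid] coord_mat_app sum_distrib_right)
  also have "\<dots> = (\<Sum>j<n. \<Sum>i<n. A i j * coord u j * coord v i)"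
    by (rule sum.swap)
  also have "\<dots> = (\<Sum>j<n. \<Sum>i<n. A j i * coord v i * coord u j)"
    using assms(1) by (intro sum.cong) auto
  also have "\<dots> = inner (mat_app n A v) u"
    by (simp add: inner_euclid[OF mat_app_euclid] coord_mat_app sum_distrib_right)
  finally show ?thesis by (simp add: inner_commute)
qed

text \<open>The orthogonal complement of the constant vectors in \<open>euclid n\<close>. There
  \<open>J\<close> vanishes, so \<open>W\<close> and \<open>W - J\<close> agree and
  \<open>mu\<close> bounds \<open>W\<close> itself.\<close>

definition mean_zero :: "nat \<Rightarrow> fsvec set"
  where "mean_zero n = {v \<in> euclid n. (\<Sum>i<n. coord v i) = 0}"

lemma subspace_mean_zero: "subspace (mean_zero n)"
  using subspace_euclid[of n]
  by (auto simp: subspace_def mean_zero_def sum.distrib sum_distrib_left[symmetric])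

text \<open>The vector, indexed by nodes, of the \<open>l\<close>-th coordinates: \<open>mat_app\<close> acts on it as \<open>W\<close> mixes nodes.\<close>

definition node_column :: "nat \<Rightarrow> (nat \<Rightarrow> fsvec) \<Rightarrow> nat \<Rightarrow> fsvec"
  where "node_column n z l = Abs_fsvec (\<lambda>i. if i < n then coord (z i) l else 0)"

lemma coord_node_column: "coord (node_column n z l) i = (if i < n then coord (z i) l else 0)"
proof -
  have "{i. (if i < n then coord (z i) l else 0) \<noteq> 0} \<subseteq> {..<n}" by auto
  then have "finite {i. (if i < n then coord (z i) l else 0) \<noteq> 0}"
    by (rule finite_subset) simp
  then have "coord (Abs_fsvec (\<lambda>i. if i < n then coord (z i) l else 0)) = (\<lambda>i. if i < n then coord (z i) l else 0)"
    by (intro Abs_fsvec_inverse) (simp only: mem_Collect_eq)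
  then show ?thesis by (simp add: node_column_def)
qed

lemma column_euclid: "node_column n z l \<in> euclid n"
  by (simp add: euclid_def coord_node_column)

text \<open>The squared Frobenius norm of the node-by-coordinate matrix, summed by columns or by
  rows.\<close>

lemma sum_norm_column:
  assumes "\<And>i. i < n \<Longrightarrow> z i \<in> euclid d"
  shows "(\<Sum>l<d. (norm (node_column n z l))\<^sup>2) = (\<Sum>i<n. (norm (z i))\<^sup>2)"
proof -
  have "(\<Sum>l<d. (norm (node_column n z l))\<^sup>2) = (\<Sum>l<d. \<Sum>i<n. coord (z i) l * coord (z i) l)"
    by (simp add: power2_norm_eq_inner inner_euclid[OF column_euclid] coord_node_column)
  also have "\<dots> = (\<Sum>i<n. \<Sum>l<d. coord (z i) l * coord (z i) l)"
    by (rule sum.swap)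
  also have "\<dots> = (\<Sum>i<n. (norm (z i))\<^sup>2)"
    using assms by (simp add: power2_norm_eq_inner inner_euclid[of _ d])
  finally show ?thesis .
qed

section \<open>Averages over the nodes\<close>

lemma average_diff: "average n (\<lambda>i. u i - v i) = average n u - average n v"
  by (simp add: average_def sum_subtractf scaleR_right_diff_distrib)

lemma average_add: "average n (\<lambda>i. u i + v i) = average n u + average n v"
  by (simp add: average_def sum.distrib scaleR_right_distrib)

lemma average_scale: "average n (\<lambda>i. r *\<^sub>R u i) = r *\<^sub>R average n u"
  by (simp add: average_def scaleR_sum_right)

lemma average_euclid: "(\<And>i. i < n \<Longrightarrow> z i \<in> euclid d) \<Longrightarrow> average n z \<in> euclid d"
  unfolding average_def
  by (intro subspace_scale[OF subspace_euclid] subspace_sum[OF subspace_euclid]) auto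

lemma sum_deviation: "(\<Sum>i<n. z i - average n z) = 0"
  by (cases "n = 0") (simp_all add: average_def sum_subtractf sum_constant_scaleR)

text \<open>Pythagoras: the deviations sum to zero, so the cross term with the average
  vanishes.\<close>

lemma sum_norm_deviation_le: "(\<Sum>i<n. (norm (z i - average n z))\<^sup>2) \<le> (\<Sum>i<n. (norm (z i))\<^sup>2)"
proof -
  have "(\<Sum>i<n. (norm (z i))\<^sup>2) = (\<Sum>i<n. (norm (z i - average n z))\<^sup>2
      + 2 * inner (z i - average n z) (average n z) + (norm (average n z))\<^sup>2)"
    by (simp add: power2_norm_eq_inner algebra_simps inner_commute)
  also have "\<dots> = (\<Sum>i<n. (norm (z i - average n z))\<^sup>2)
      + 2 * inner (\<Sum>i<n. z i - average n z) (average n z) + real n * (norm (average n z))\<^sup>2"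
    by (simp add: sum.distrib inner_sum_left sum_distrib_left)
  finally show ?thesis unfolding sum_deviation by simp
qed

lemma norm_average_le:
  assumes "n > 0" "\<And>i. i < n \<Longrightarrow> norm (z i) \<le> b"
  shows "norm (average n z) \<le> b"
proof -
  have "norm (\<Sum>i<n. z i) \<le> real n * b"
    using sum_norm_bound[of "{..<n}" z b] assms by simp
  then show ?thesis using assms(1) by (simp add: average_def field_simps)
qed

section \<open>Convex functions with Lipschitz gradient\<close>

text \<open>Along the line through \<open>y\<close> and \<open>z\<close>, which stays in
  \<open>euclid d\<close>, this is the tangent inequality for a convex function of one real
  variable.\<close>

lemma gradient_inequality:
  assumes h: "convex_on (euclid d) h" and g: "gradient_on (euclid d) h g"
    and y: "y \<in> euclid d" and z: "z \<in> euclid d"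
  shows "h y + inner (g y) (z - y) \<le> h z"
proof -
  define p where "p t = y + t *\<^sub>R (z - y)" for t
  have p: "p t \<in> euclid d" for t
    unfolding p_def using y z
    by (intro subspace_add[OF subspace_euclid] subspace_scale[OF subspace_euclid] subspace_diff[OF subspace_euclid])
  have "convex_on UNIV (\<lambda>t. h (p t))"
  proof (rule convex_onI)
    fix t a b :: real assume t: "0 < t" "t < 1"
    have "p ((1 - t) *\<^sub>R a + t *\<^sub>R b) = (1 - t) *\<^sub>R p a + t *\<^sub>R p b"
      by (simp add: p_def algebra_simps)
    then show "h (p ((1 - t) *\<^sub>R a + t *\<^sub>R b)) \<le> (1 - t) * h (p a) + t * h (p b)"
      using convex_onD[OF h _ _ p p, of t a b] t by simp
  qed simp
  moreover have "((\<lambda>t. h (p t)) has_field_derivative inner (g y) (z - y)) (at 0)"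
  proof -
    have "(p has_derivative (\<lambda>t. t *\<^sub>R (z - y))) (at 0)"
      unfolding p_def by (auto intro!: derivative_eq_intros)
    moreover have "(h has_derivative (\<lambda>v. inner (g y) v)) (at (p 0) within range p)"
      using g y p by (auto simp: gradient_on_def p_def intro: has_derivative_subset)
    ultimately have "((\<lambda>t. h (p t)) has_derivative (\<lambda>t. inner (g y) (t *\<^sub>R (z - y)))) (at 0)"
      by (rule has_derivative_in_compose)
    then show ?thesis
      by (simp add: has_field_derivative_def mult.commute[of _ "inner _ _"])
  qed
  ultimately have "inner (g y) (z - y) * (1 - 0) \<le> h (p 1) - h (p 0)"
    by (intro convex_on_imp_above_tangent[of UNIV]) auto
  then show ?thesis by (simp add: p_def)
qed

text \<open>Convexity at \<open>z\<close> gives \<open>h z - h y \<le> inner (g z) (z - y)\<close>,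
  and replacing \<open>g z\<close> by \<open>g y\<close> costs \<open>L\<close> times the squared
  distance. This avoids integrating along the segment, at the price of \<open>L\<close> in place of
  \<open>L / 2\<close>.\<close>

lemma smooth_upper_bound:
  assumes h: "convex_on (euclid d) h" and g: "gradient_on (euclid d) h g"
    and L: "L-lipschitz_on (euclid d) g"
    and y: "y \<in> euclid d" and z: "z \<in> euclid d"
  shows "h z \<le> h y + inner (g y) (z - y) + L * (norm (z - y))\<^sup>2"
proof -
  have "inner (g z - g y) (z - y) \<le> norm (g z - g y) * norm (z - y)"
    by (rule norm_cauchy_schwarz)
  also have "\<dots> \<le> L * norm (z - y) * norm (z - y)"
    using lipschitz_onD[OF L z y] by (intro mult_right_mono) (auto simp: dist_norm)
  finally show ?thesis
    using gradient_inequality[OF h g z y]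
    by (simp add: power2_eq_square inner_diff_left inner_diff_right)
qed


lemma norm_extrapolation_le:
  fixes a b :: "'a::real_inner"
  assumes "0 \<le> t" "t \<le> 1"
  shows "(norm (a + t *\<^sub>R (a - b)))\<^sup>2 \<le> 8 * (norm a)\<^sup>2 + 2 * (norm b)\<^sup>2"
proof -
  have "norm (a + t *\<^sub>R (a - b)) \<le> norm a + t * norm (a - b)"
    using norm_triangle_ineq[of a "t *\<^sub>R (a - b)"] assms by simp
  also have "\<dots> \<le> norm a + 1 * (norm a + norm b)"
    using assms norm_triangle_ineq4[of a b] by (intro add_left_mono mult_mono) auto
  finally have "(norm (a + t *\<^sub>R (a - b)))\<^sup>2 \<le> (2 * norm a + norm b)\<^sup>2"
    by (intro power_mono) auto
  also have "\<dots> \<le> 8 * (norm a)\<^sup>2 + 2 * (norm b)\<^sup>2"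
    using zero_le_power2[of "2 * norm a - norm b"] by (simp add: power2_eq_square algebra_simps)
  finally show ?thesis .
qed

section \<open>Averages and deviations of the D--NG iterates\<close>

context dng
begin

abbreviation dev :: "(nat \<Rightarrow> fsvec) \<Rightarrow> nat \<Rightarrow> fsvec"
  where "dev z i \<equiv> z i - average N z"

definition grads :: "nat \<Rightarrow> nat \<Rightarrow> fsvec"
  where "grads k i = g i (y k i)"

lemma L_nonneg: "0 \<le> L"
  using gradient_lipschitz[of 0] nodes lipschitz_on_nonneg by fastforce

lemma G_nonneg: "0 \<le> G"
  using order_trans[OF norm_ge_zero gradient_bounded[of 0 0]] nodes subspace_0[OF subspace_euclid]
  by simp

lemma xstar_mem: "xstar \<in> euclid d"
  and xstar_le: "z \<in> euclid d \<Longrightarrow> objective N f xstar \<le> objective N f z"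
  using minimizer by (auto simp: is_arg_min_linorder)

text \<open>Off the neighborhood \<open>W i j\<close> is nonnegative but not positive, hence
  zero.\<close>

lemma mix_eq:
  fixes z :: "nat \<Rightarrow> fsvec"
  assumes i: "i < N"
  shows "(\<Sum>j\<in>nbhd H i. W i j *\<^sub>R z j) = (\<Sum>j<N. W i j *\<^sub>R z j)"
proof (rule sum.mono_neutral_left)
  interpret pair_graph H by (rule graph(1))
  show "nbhd H i \<subseteq> {..<N}"
    using i graph(2) wellformed by (force simp: nbhd_def)
  show "\<forall>j\<in>{..<N} - nbhd H i. W i j *\<^sub>R z j = 0"
  proof
    fix j assume j: "j \<in> {..<N} - nbhd H i"
    then have "\<not> W i j > 0" using weights_graph[of i j] i by (auto simp: nbhd_def)
    moreover have "W i j \<ge> 0" using weights_stochastic i j by (auto simp: doubly_stochastic_def)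
    ultimately show "W i j *\<^sub>R z j = 0" by simp
  qed
qed simp

lemma x_step_full_sum: "i < N \<Longrightarrow> x (Suc k) i = (\<Sum>j<N. W i j *\<^sub>R y k j) - step_size c k *\<^sub>R grads k i"
  by (simp add: x_step mix_eq grads_def)

lemma row_sum: "i < N \<Longrightarrow> (\<Sum>j<N. W i j) = 1"
  and col_sum: "j < N \<Longrightarrow> (\<Sum>i<N. W i j) = 1"
  using weights_stochastic by (auto simp: doubly_stochastic_def)

text \<open>Unit column sums conserve the average, so mixing disappears from the averaged
  dynamics.\<close>

lemma average_mix: "average N (\<lambda>i. \<Sum>j<N. W i j *\<^sub>R z j) = average N z"
proof -
  have "(\<Sum>i<N. \<Sum>j<N. W i j *\<^sub>R z j) = (\<Sum>j<N. \<Sum>i<N. W i j *\<^sub>R z j)"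
    by (rule sum.swap)
  also have "\<dots> = (\<Sum>j<N. z j)"
    by (simp add: col_sum flip: scaleR_sum_left)
  finally show ?thesis by (simp add: average_def)
qed

lemma average_cong: "(\<And>i. i < N \<Longrightarrow> u i = v i) \<Longrightarrow> average N u = average N v"
  by (simp add: average_def)

lemma average_x_step: "average N (x (Suc k)) = average N (y k) - step_size c k *\<^sub>R average N (grads k)"
proof -
  have "average N (x (Suc k)) = average N (\<lambda>i. (\<Sum>j<N. W i j *\<^sub>R y k j) - step_size c k *\<^sub>R grads k i)"
    by (rule average_cong) (rule x_step_full_sum)
  then show ?thesis by (simp only: average_diff average_scale average_mix)
qed

lemma average_y_step: "average N (y (Suc k))
    = average N (x (Suc k)) + momentum k *\<^sub>R (average N (x (Suc k)) - average N (x k))"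
proof -
  have "average N (y (Suc k)) = average N (\<lambda>i. x (Suc k) i + momentum k *\<^sub>R (x (Suc k) i - x k i))"
    by (rule average_cong) (rule y_step)
  then show ?thesis by (simp only: average_diff average_scale average_add)
qed

lemma average_y_0: "average N (y 0) = average N (x 0)"
  by (rule average_cong) (rule initial_y)

lemma iterates_mem: "\<forall>i<N. x k i \<in> euclid d \<and> y k i \<in> euclid d"
proof (induction k)
  case 0
  show ?case using initial_euclid initial_y by simp
next
  case (Suc k)
  have "x (Suc k) i \<in> euclid d" if "i < N" for i
    unfolding x_step_full_sum[OF that] grads_def using Suc gradient that
    by (intro subspace_diff[OF subspace_euclid] subspace_sum[OF subspace_euclid] subspace_scale[OF subspace_euclid])
       (auto simp: gradient_on_def)
  then show ?case using Suc
    by (auto simp: y_step intro!: subspace_add[OF subspace_euclid] subspace_diff[OF subspace_euclid] subspace_scale[OF subspace_euclid])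
qed

lemma x_mem: "i < N \<Longrightarrow> x k i \<in> euclid d" and y_mem: "i < N \<Longrightarrow> y k i \<in> euclid d"
  and grads_mem: "i < N \<Longrightarrow> grads k i \<in> euclid d"
  using iterates_mem gradient by (auto simp: grads_def gradient_on_def)

lemma dev_mem: "(\<And>i. i < N \<Longrightarrow> z i \<in> euclid d) \<Longrightarrow> i < N \<Longrightarrow> dev z i \<in> euclid d"
  by (intro subspace_diff[OF subspace_euclid] average_euclid) auto

lemma norm_grads: "i < N \<Longrightarrow> norm (grads k i) \<le> G"
  by (simp add: grads_def gradient_bounded y_mem)

lemma column_dev_mem: "node_column N (dev z) l \<in> mean_zero N"
proof -
  have "(\<Sum>i<N. coord (node_column N (dev z) l) i) = coord (\<Sum>i<N. dev z i) l"
    by (simp add: coord_node_column)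
  then show ?thesis unfolding sum_deviation by (simp add: mean_zero_def column_euclid)
qed

section \<open>Disagreement between the nodes\<close>

lemma mu_nonneg: "0 \<le> mu N W"
  unfolding mu_def spectral_norm_def by (rule onorm_pos_le[OF bounded_linear_mat_app])

text \<open>Symmetry gives selfadjointness, unit column sums keep the mean zero, the lower bound
  \<open>\<eta> I\<close> gives semidefiniteness, and the norm bound holds because
  \<open>W - J\<close> acts as \<open>W\<close> on mean-zero vectors.\<close>

lemma psd_contraction_W:
  assumes "0 \<le> \<eta>"
  shows "psd_contraction (mean_zero N) (mat_app N W) (mu N W)"
proof (rule psd_contraction.intro)
  show "subspace (mean_zero N)" by (rule subspace_mean_zero)
  show "linear (mat_app N W)" by (rule linear_mat_app)
  show "0 \<le> mu N W" "mu N W < 1" by (fact mu_nonneg mu_less_1)+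
  show "inner (mat_app N W u) v = inner u (mat_app N W v)" if "u \<in> mean_zero N" "v \<in> mean_zero N" for u v
    using that weights_symmetric by (intro mat_app_selfadjoint) (auto simp: mean_zero_def)
  fix u assume u: "u \<in> mean_zero N"
  have "(\<Sum>i<N. \<Sum>j<N. W i j * coord u j) = (\<Sum>j<N. \<Sum>i<N. W i j * coord u j)"
    by (rule sum.swap)
  also have "\<dots> = 0" using u by (simp add: col_sum mean_zero_def flip: sum_distrib_right)
  finally show "mat_app N W u \<in> mean_zero N"
    by (simp add: mean_zero_def mat_app_euclid coord_mat_app)
  have "mat_app N (\<lambda>i j. W i j - \<eta> * (if i = j then 1 else 0)) u = mat_app N W u - \<eta> *\<^sub>R u"
  proof (rule fsvec_eqI)
    fix i
    have "coord u i = 0" if "\<not> i < N" using u that by (simp add: mean_zero_def euclid_def)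
    moreover have "(\<Sum>j<N. \<eta> * (if i = j then 1 else 0) * coord u j) = \<eta> * coord u i" if "i < N"
      using that by (simp add: if_distrib[of "\<lambda>t. _ * t * _"] cong: if_cong)
    ultimately show "coord (mat_app N (\<lambda>i j. W i j - \<eta> * (if i = j then 1 else 0)) u) i
        = coord (mat_app N W u - \<eta> *\<^sub>R u) i"
      by (simp add: coord_mat_app left_diff_distrib sum_subtractf)
  qed
  moreover have "0 \<le> inner u (mat_app N (\<lambda>i j. W i j - \<eta> * (if i = j then 1 else 0)) u)"
    using weights_lower u by (simp add: psd_def mean_zero_def)
  ultimately have "\<eta> * inner u u \<le> inner (mat_app N W u) u"
    by (simp add: inner_diff_right inner_commute)
  then show "0 \<le> inner (mat_app N W u) u"
    using assms mult_nonneg_nonneg[OF assms inner_ge_zero[of u]] by linarith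
  have "mat_app N (\<lambda>i j. W i j - 1 / real N) u = mat_app N W u"
    using u by (intro fsvec_eqI) (auto simp: coord_mat_app left_diff_distrib sum_subtractf mean_zero_def
      simp flip: sum_divide_distrib)
  then show "norm (mat_app N W u) \<le> mu N W * norm u"
    using onorm[OF bounded_linear_mat_app, of N "\<lambda>i j. W i j - 1 / real N" u]
    by (simp add: mu_def spectral_norm_def)
qed

text \<open>Mixing acts on each coordinate column separately as \<open>mat_app N W\<close>; the
  coordinates are coupled only through the gradients, which enter as the bounded forcing
  \<open>F\<close>.\<close>

definition X :: "nat \<Rightarrow> nat \<Rightarrow> fsvec" where "X k l = node_column N (dev (x k)) l"
definition Y :: "nat \<Rightarrow> nat \<Rightarrow> fsvec" where "Y k l = node_column N (dev (y k)) l"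
definition F :: "nat \<Rightarrow> nat \<Rightarrow> fsvec" where "F k l = node_column N (dev (grads k)) l"

lemma dev_x_step:
  assumes "i < N"
  shows "dev (x (Suc k)) i = (\<Sum>j<N. W i j *\<^sub>R dev (y k) j) - step_size c k *\<^sub>R dev (grads k) i"
proof -
  have "(\<Sum>j<N. W i j *\<^sub>R dev (y k) j) = (\<Sum>j<N. W i j *\<^sub>R y k j) - average N (y k)"
    using row_sum[OF assms] by (simp add: scaleR_right_diff_distrib sum_subtractf flip: scaleR_sum_left)
  then show ?thesis
    unfolding average_x_step x_step_full_sum[OF assms] by (simp add: algebra_simps)
qed

lemma dev_y_step:
  "i < N \<Longrightarrow> dev (y (Suc k)) i = dev (x (Suc k)) i + momentum k *\<^sub>R (dev (x (Suc k)) i - dev (x k) i)"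
  unfolding average_y_step by (simp add: y_step algebra_simps)

lemma X_step: "X (Suc k) l = mat_app N W (Y k l) - step_size c k *\<^sub>R F k l"
proof (rule fsvec_eqI)
  fix i
  show "coord (X (Suc k) l) i = coord (mat_app N W (Y k l) - step_size c k *\<^sub>R F k l) i"
  proof (cases "i < N")
    case True
    have "coord (X (Suc k) l) i
        = coord ((\<Sum>j<N. W i j *\<^sub>R dev (y k) j) - step_size c k *\<^sub>R dev (grads k) i) l"
      using True by (simp only: X_def coord_node_column dev_x_step if_True)
    then show ?thesis using True by (simp add: Y_def F_def coord_node_column coord_mat_app)
  qed (simp add: X_def F_def coord_node_column coord_mat_app)
qed

lemma Y_step: "Y (Suc k) l = X (Suc k) l + momentum k *\<^sub>R (X (Suc k) l - X k l)"
proof (rule fsvec_eqI)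
  fix i
  show "coord (Y (Suc k) l) i = coord (X (Suc k) l + momentum k *\<^sub>R (X (Suc k) l - X k l)) i"
  proof (cases "i < N")
    case True
    have "coord (Y (Suc k) l) i
        = coord (dev (x (Suc k)) i + momentum k *\<^sub>R (dev (x (Suc k)) i - dev (x k) i)) l"
      using True by (simp only: Y_def coord_node_column dev_y_step if_True)
    then show ?thesis using True by (simp add: X_def coord_node_column)
  qed (simp add: X_def Y_def coord_node_column)
qed

lemma dev_x_0:
  assumes i: "i < N"
  shows "dev (x 0) i = 0"
proof -
  have "average N (x 0) = average N (\<lambda>_. x 0 i)"
    by (rule average_cong, rule initial_common) (use i in simp_all)
  also have "\<dots> = x 0 i" using i by (simp add: average_def sum_constant_scaleR)
  finally show ?thesis by simp
qed

lemma X_0: "X 0 l = 0"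
  by (rule fsvec_eqI) (simp add: X_def coord_node_column dev_x_0 del: coord_simps(4))

lemma Y_0: "Y 0 l = 0"
  by (rule fsvec_eqI) (simp add: Y_def coord_node_column average_y_0 initial_y dev_x_0 del: coord_simps(4))

lemma momentum_bounds: "0 \<le> momentum k" "momentum k \<le> 1"
  by (simp_all add: momentum_def)

lemma F_bound: "L2_set (\<lambda>l. norm (F k l)) {..<d} \<le> sqrt (real N) * G"
proof -
  have "(\<Sum>l<d. (norm (F k l))\<^sup>2) = (\<Sum>i<N. (norm (dev (grads k) i))\<^sup>2)"
    unfolding F_def by (intro sum_norm_column dev_mem grads_mem)
  also have "\<dots> \<le> (\<Sum>i<N. (norm (grads k i))\<^sup>2)" by (rule sum_norm_deviation_le)
  also have "\<dots> \<le> (\<Sum>i<N. G\<^sup>2)"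
    using norm_grads by (intro sum_mono power_mono) auto
  finally have "sqrt (\<Sum>l<d. (norm (F k l))\<^sup>2) \<le> sqrt (real N * G\<^sup>2)" by simp
  then show ?thesis using G_nonneg by (simp add: L2_set_def real_sqrt_mult)
qed

text \<open>The square of the constant of \<open>recursion_bound\<close> for
  \<open>s = \<xi> / 2\<close>, with \<open>3 / (1 - sqrt \<mu>)\<close> enlarged to
  \<open>6 / (1 - \<mu>)\<close>, and divided by the \<open>1 - \<mu>\<close> of
  \<open>energy_ge\<close>.\<close>

definition consensus_constant :: "real \<Rightarrow> real"
  where "consensus_constant \<xi> = (1 + 2 / \<xi>)\<^sup>2 * 6 powr (2 + \<xi>) / (1 - mu N W) powr (3 + \<xi>)"

lemma x_disagreement:
  assumes \<eta>: "0 \<le> \<eta>" and c: "c > 0" and \<xi>: "0 < \<xi>" "\<xi> < 1"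
  shows "(\<Sum>i<N. (norm (dev (x k) i))\<^sup>2) \<le> real N * (c * G)\<^sup>2 * consensus_constant \<xi> / (real k)\<^sup>2"
proof (cases k)
  case 0
  \<comment> \<open>At time 0 the right-hand side is a division by zero, hence 0; the common start
    makes the left-hand side 0 as well.\<close>
  then show ?thesis by (simp add: dev_x_0)
next
  case (Suc n)
  let ?\<mu> = "mu N W"
  interpret psd_contraction "mean_zero N" "mat_app N W" ?\<mu>
    by (rule psd_contraction_W[OF \<eta>])
  define r where "r = sqrt ?\<mu>"
  define e where "e = c * (sqrt (real N) * G)"
  \<comment> \<open>Combining the \<open>d\<close> coordinates by \<open>L2_set\<close> lets
    Minkowski's inequality carry the recursion over with constants free of \<open>d\<close>.\<close>
  define q where "q k = L2_set (\<lambda>l. sqrt (energy (X (Suc k) l) (X k l))) {..<d}" for k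
  define s where "s = \<xi> / 2"
  have r: "0 \<le> r" "r < 1" using mu_bounds by (auto simp: r_def)
  have Xm: "X k l \<in> mean_zero N" and Ym: "Y k l \<in> mean_zero N" and Fm: "F k l \<in> mean_zero N" for k l
    by (simp_all add: X_def Y_def F_def column_dev_mem)
  note mem = subspace_scale[OF subspace]
  have forcing: "L2_set (\<lambda>l. norm (- (step_size c k *\<^sub>R F k l))) {..<d} \<le> e / real (k + 1)" for k
  proof -
    have "0 \<le> step_size c k" using c by (simp add: step_size_def)
    then have "L2_set (\<lambda>l. norm (- (step_size c k *\<^sub>R F k l))) {..<d}
        = step_size c k * L2_set (\<lambda>l. norm (F k l)) {..<d}"
      by (simp add: L2_set_right_distrib)
    also have "\<dots> \<le> step_size c k * (sqrt (real N) * G)"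
      using c by (intro mult_left_mono F_bound) (simp add: step_size_def)
    finally show ?thesis by (simp add: step_size_def e_def)
  qed
  \<comment> \<open>All deviations vanish at time 0, so \<open>X 1\<close> is the first forcing
    alone and its energy is its squared norm.\<close>
  have q0: "q 0 \<le> e"
    using forcing[of 0] linear_0[OF linear]
    by (simp add: q_def X_step X_0 Y_0 energy_zero)
  have qstep: "q (Suc k) \<le> r * q k + e / real (k + 2)" for k
  proof -
    have "q (Suc k) \<le> L2_set (\<lambda>l. r * sqrt (energy (X (Suc k) l) (X k l))
        + norm (- (step_size c (Suc k) *\<^sub>R F (Suc k) l))) {..<d}"
      unfolding q_def
    proof (rule L2_set_mono)
      fix l
      have "sqrt (energy (X (Suc (Suc k)) l) (X (Suc k) l))
          \<le> sqrt (energy (mat_app N W (Y (Suc k) l)) (X (Suc k) l))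
            + norm (- (step_size c (Suc k) *\<^sub>R F (Suc k) l))"
        unfolding X_step[of "Suc k"] diff_conv_add_uminus
        by (intro sqrt_energy_add_le maps_to Xm Ym subspace_neg[OF subspace] mem Fm)
      also have "sqrt (energy (mat_app N W (Y (Suc k) l)) (X (Suc k) l))
          \<le> sqrt (?\<mu> * energy (X (Suc k) l) (X k l))"
        unfolding Y_step by (intro real_sqrt_le_mono energy_momentum_step Xm momentum_bounds)
      finally show "sqrt (energy (X (Suc (Suc k)) l) (X (Suc k) l))
          \<le> r * sqrt (energy (X (Suc k) l) (X k l)) + norm (- (step_size c (Suc k) *\<^sub>R F (Suc k) l))"
        by (simp add: r_def real_sqrt_mult)
    qed (use energy_nonneg[OF Xm Xm] in auto)
    also have "\<dots> \<le> L2_set (\<lambda>l. r * sqrt (energy (X (Suc k) l) (X k l))) {..<d}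
        + L2_set (\<lambda>l. norm (- (step_size c (Suc k) *\<^sub>R F (Suc k) l))) {..<d}"
      by (rule L2_set_triangle_ineq)
    also have "\<dots> \<le> r * q k + e / real (k + 2)"
      using forcing[of "Suc k"] r by (simp add: q_def L2_set_right_distrib add.commute)
    finally show ?thesis .
  qed
  have e: "0 \<le> e" using c G_nonneg by (simp add: e_def)
  have q_nonneg: "0 \<le> q k" for k by (simp add: q_def L2_set_nonneg)
  have "real (n + 1) * q n \<le> e * ((1 + 1 / s) * (3 / (1 - r)) powr (1 + s))"
    by (rule recursion_bound[OF r _ _ e q0 qstep q_nonneg]) (use \<xi> in \<open>auto simp: s_def\<close>)
  also have "\<dots> \<le> e * ((1 + 1 / s) * (6 / (1 - ?\<mu>)) powr (1 + s))"
  proof -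
    \<comment> \<open>This says \<open>1 - r^2 \<le> 2 (1 - r)\<close>, which converts the gap of
      \<open>sqrt \<mu>\<close> into the gap of \<open>\<mu>\<close>.\<close>
    have "0 \<le> (1 - r)\<^sup>2" by simp
    then have "1 - ?\<mu> \<le> 2 * (1 - r)" using mu_nonneg by (simp add: r_def power2_eq_square algebra_simps)
    then have "3 / (1 - r) \<le> 6 / (1 - ?\<mu>)" using r mu_less_1 by (simp add: divide_simps)
    then show ?thesis using e \<xi> r by (intro mult_left_mono powr_mono2) (auto simp: s_def)
  qed
  finally have "(real (n + 1) * q n)\<^sup>2 \<le> (e * ((1 + 1 / s) * (6 / (1 - ?\<mu>)) powr (1 + s)))\<^sup>2"
    using q_nonneg by (intro power_mono) auto
  also have "\<dots> = real N * (c * G)\<^sup>2 * consensus_constant \<xi> * (1 - ?\<mu>)"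
  proof -
    have "((6 / (1 - ?\<mu>)) powr (1 + s))\<^sup>2 = (6 / (1 - ?\<mu>)) powr (2 + \<xi>)"
      by (simp add: power2_eq_square s_def flip: powr_add)
    also have "\<dots> = 6 powr (2 + \<xi>) / (1 - ?\<mu>) powr (2 + \<xi>)"
      using mu_less_1 by (simp add: powr_divide)
    also have "\<dots> = 6 powr (2 + \<xi>) / (1 - ?\<mu>) powr (3 + \<xi>) * (1 - ?\<mu>)"
      using mu_less_1 powr_add[of "1 - ?\<mu>" "2 + \<xi>" 1] by (simp add: add.commute)
    finally show ?thesis
      by (simp add: e_def power_mult_distrib consensus_constant_def s_def)
  qed
  finally have bound: "(real (n + 1))\<^sup>2 * (q n)\<^sup>2 \<le> real N * (c * G)\<^sup>2 * consensus_constant \<xi> * (1 - ?\<mu>)"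
    by (simp add: power_mult_distrib)
  \<comment> \<open>Passing from energy to norm costs the last factor
    \<open>1 - \<mu>\<close>.\<close>
  have "(1 - ?\<mu>) * (\<Sum>i<N. (norm (dev (x k) i))\<^sup>2) = (\<Sum>l<d. (1 - ?\<mu>) * (norm (X k l))\<^sup>2)"
    unfolding X_def by (subst sum_norm_column[where d = d, symmetric])
      (simp_all add: sum_distrib_left dev_mem x_mem)
  also have "\<dots> \<le> (\<Sum>l<d. (sqrt (energy (X (Suc n) l) (X n l)))\<^sup>2)"
    using energy_ge[OF Xm Xm] energy_nonneg[OF Xm Xm] by (intro sum_mono) (simp add: Suc)
  also have "\<dots> = (q n)\<^sup>2"
    by (simp add: q_def L2_set_def sum_nonneg)
  finally have "(real (n + 1))\<^sup>2 * ((1 - ?\<mu>) * (\<Sum>i<N. (norm (dev (x k) i))\<^sup>2)) \<le> (real (n + 1))\<^sup>2 * (q n)\<^sup>2"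
    by (rule mult_left_mono) simp
  with bound have "(1 - ?\<mu>) * ((real (n + 1))\<^sup>2 * (\<Sum>i<N. (norm (dev (x k) i))\<^sup>2))
      \<le> (1 - ?\<mu>) * (real N * (c * G)\<^sup>2 * consensus_constant \<xi>)"
    by (simp add: algebra_simps)
  then have "(real (n + 1))\<^sup>2 * (\<Sum>i<N. (norm (dev (x k) i))\<^sup>2) \<le> real N * (c * G)\<^sup>2 * consensus_constant \<xi>"
    using mu_less_1 by (simp only: mult_le_cancel_left_pos diff_gt_0_iff_gt)
  then show ?thesis using Suc by (simp add: pos_le_divide_eq mult.commute)
qed

text \<open>Lets the step-length error, which lacks this factor, be merged with the disagreement
  error.\<close>

lemma consensus_constant_ge_1:
  assumes "0 < \<xi>" "\<xi> < 1"
  shows "1 \<le> consensus_constant \<xi>"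
proof -
  have "(1 - mu N W) powr (3 + \<xi>) \<le> 1"
    using mu_nonneg mu_less_1 assms by (intro powr_le1) auto
  moreover have "(1::real) * 1 \<le> (1 + 2 / \<xi>)\<^sup>2 * 6 powr (2 + \<xi>)"
    using assms by (intro mult_mono one_le_power ge_one_powr_ge_zero) auto
  ultimately have "(1 - mu N W) powr (3 + \<xi>) \<le> (1 + 2 / \<xi>)\<^sup>2 * 6 powr (2 + \<xi>)" by simp
  then show ?thesis using mu_less_1 by (simp add: consensus_constant_def)
qed

lemma y_disagreement:
  assumes \<eta>: "0 \<le> \<eta>" and c: "c > 0" and \<xi>: "0 < \<xi>" "\<xi> < 1"
  shows "(\<Sum>i<N. (norm (dev (y k) i))\<^sup>2) \<le> 64 * (real N * (c * G)\<^sup>2 * consensus_constant \<xi>) / (real (k + 1))\<^sup>2"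
proof -
  define M where "M = real N * (c * G)\<^sup>2 * consensus_constant \<xi>"
  have M: "0 \<le> M" using consensus_constant_ge_1[OF \<xi>] by (simp add: M_def)
  note xd = x_disagreement[OF \<eta> c \<xi>, folded M_def]
  show ?thesis
  proof (cases k)
    case 0
    then show ?thesis
      using M by (simp add: average_y_0 initial_y dev_x_0 M_def)
  next
    case (Suc n)
    have "(\<Sum>i<N. (norm (dev (y (Suc n)) i))\<^sup>2)
        \<le> (\<Sum>i<N. 8 * (norm (dev (x (Suc n)) i))\<^sup>2 + 2 * (norm (dev (x n) i))\<^sup>2)"
    proof (rule sum_mono)
      fix i assume "i \<in> {..<N}"
      then show "(norm (dev (y (Suc n)) i))\<^sup>2
          \<le> 8 * (norm (dev (x (Suc n)) i))\<^sup>2 + 2 * (norm (dev (x n) i))\<^sup>2"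
        using norm_extrapolation_le[OF momentum_bounds, of "dev (x (Suc n)) i" n "dev (x n) i"]
        by (simp only: dev_y_step lessThan_iff)
    qed
    also have "\<dots> = 8 * (\<Sum>i<N. (norm (dev (x (Suc n)) i))\<^sup>2) + 2 * (\<Sum>i<N. (norm (dev (x n) i))\<^sup>2)"
      by (simp add: sum.distrib sum_distrib_left)
    also have "\<dots> \<le> 8 * (M / (real (Suc n))\<^sup>2) + 2 * (M / (real n)\<^sup>2)"
      by (intro add_mono mult_left_mono xd) auto
    also have "\<dots> = M * (8 / (real (Suc n))\<^sup>2 + 2 / (real n)\<^sup>2)"
      by (simp add: algebra_simps)
    also have "\<dots> \<le> M * (64 / (real n + 2)\<^sup>2)"
    proof (rule mult_left_mono[OF _ M])
      have "(real n + 2)\<^sup>2 \<le> (2 * real (Suc n))\<^sup>2" by (intro power_mono) auto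
      then have 1: "8 / (real (Suc n))\<^sup>2 \<le> 32 / (real n + 2)\<^sup>2"
        by (simp only: power_mult_distrib) (simp add: field_simps)
      \<comment> \<open>For \<open>n = 0\<close> the left-hand side is a division by zero, in line
        with the vanishing disagreement at time 0. The two parts make \<open>32 + 18 = 50\<close>,
        rounded up to 64.\<close>
      have 2: "2 / (real n)\<^sup>2 \<le> 18 / (real n + 2)\<^sup>2"
      proof (cases "n = 0")
        case False
        then have "(real n + 2)\<^sup>2 \<le> (3 * real n)\<^sup>2" by (intro power_mono) auto
        then show ?thesis using False by (simp add: field_simps power_mult_distrib)
      qed simp
      have "50 / (real n + 2)\<^sup>2 \<le> 64 / (real n + 2)\<^sup>2" by (intro divide_right_mono) auto
      then show "8 / (real (Suc n))\<^sup>2 + 2 / (real n)\<^sup>2 \<le> 64 / (real n + 2)\<^sup>2"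
        using 1 2 by simp
    qed
    finally show ?thesis by (simp add: Suc M_def algebra_simps)
  qed
qed

section \<open>Suboptimality of the average\<close>

text \<open>The normalization makes \<open>average N (grads k)\<close> an inexact gradient of
  \<open>h\<close>, with constants independent of \<open>N\<close>.\<close>

definition h :: "fsvec \<Rightarrow> real"
  where "h z = 1 / real N * objective N f z"

lemma convex_h: "convex_on (euclid d) h"
proof -
  have "convex_on (euclid d) (\<lambda>z. \<Sum>i<n. f i z)" if "n \<le> N" for n
    using that
  proof (induction n)
    case (Suc n)
    then show ?case using convex_on_add[OF Suc.IH convex[of n]] by simp
  qed (simp add: convex_on_def subspace_imp_convex[OF subspace_euclid])
  then show ?thesis
    unfolding h_def objective_def by (intro convex_on_cmul) auto
qed

lemma xbar_mem: "average N (x k) \<in> euclid d" and ybar_mem: "average N (y k) \<in> euclid d"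
  by (auto intro!: average_euclid x_mem y_mem)

text \<open>At each node, smoothness and convexity at its own \<open>y k i\<close> compare
  \<open>f i\<close> at the average with \<open>f i u\<close>; summing brings in the averaged
  gradient, along which the average steps. Two errors remain: the step length, bounded through
  \<open>G\<close>, and the disagreement.\<close>

lemma h_step:
  assumes u: "u \<in> euclid d" and c: "c > 0"
  defines "\<alpha> \<equiv> \<lambda>k. step_size c k"
  shows "h (average N (x (Suc k))) \<le> h u
    + ((norm (average N (y k) - u))\<^sup>2 - (norm (average N (x (Suc k)) - u))\<^sup>2) / (2 * \<alpha> k)
    + (2 * L * (\<alpha> k * G)\<^sup>2 + 2 * L / real N * (\<Sum>i<N. (norm (dev (y k) i))\<^sup>2))"
proof -
  let ?x = "average N (x (Suc k))" and ?y = "average N (y k)" and ?g = "average N (grads k)"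
  have N: "real N > 0" using nodes by simp
  have \<alpha>: "\<alpha> k > 0" using c by (simp add: \<alpha>_def step_size_def)
  have node: "f i ?x \<le> f i u + inner (grads k i) (?x - u)
      + 2 * L * (norm (?x - ?y))\<^sup>2 + 2 * L * (norm (dev (y k) i))\<^sup>2" if i: "i < N" for i
  proof -
    have "f i ?x \<le> f i (y k i) + inner (grads k i) (?x - y k i) + L * (norm (?x - y k i))\<^sup>2"
      unfolding grads_def using i
      by (intro smooth_upper_bound[where d = d] convex gradient gradient_lipschitz y_mem xbar_mem)
    moreover have "f i (y k i) \<le> f i u - inner (grads k i) (u - y k i)"
      using gradient_inequality[OF convex gradient y_mem u, OF i i i] by (simp add: grads_def algebra_simps)
    moreover have "L * (norm (?x - y k i))\<^sup>2 \<le> L * (2 * (norm (?x - ?y))\<^sup>2 + 2 * (norm (dev (y k) i))\<^sup>2)"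
    proof -
      \<comment> \<open>The parallelogram identity, for
        \<open>?x - y k i = (?x - ?y) - dev (y k) i\<close>.\<close>
      have "0 \<le> (norm ((?x - ?y) + dev (y k) i))\<^sup>2" by simp
      also have "\<dots> = 2 * (norm (?x - ?y))\<^sup>2 + 2 * (norm (dev (y k) i))\<^sup>2 - (norm ((?x - ?y) - dev (y k) i))\<^sup>2"
        by (simp add: power2_norm_eq_inner inner_diff_left inner_diff_right inner_add_left inner_add_right inner_commute)
      finally show ?thesis using L_nonneg by (intro mult_left_mono) (simp_all add: algebra_simps)
    qed
    ultimately show ?thesis by (simp add: inner_diff_right algebra_simps)
  qed
  have "objective N f ?x \<le> (\<Sum>i<N. f i u + inner (grads k i) (?x - u)
      + 2 * L * (norm (?x - ?y))\<^sup>2 + 2 * L * (norm (dev (y k) i))\<^sup>2)"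
    unfolding objective_def by (intro sum_mono node) simp
  also have "\<dots> = objective N f u + real N * inner ?g (?x - u)
      + real N * (2 * L * (norm (?x - ?y))\<^sup>2) + 2 * L * (\<Sum>i<N. (norm (dev (y k) i))\<^sup>2)"
    using N by (simp add: sum.distrib objective_def sum_distrib_left inner_sum_left average_def)
  finally have "h ?x \<le> h u + inner ?g (?x - u) + 2 * L * (norm (?x - ?y))\<^sup>2
      + 2 * L / real N * (\<Sum>i<N. (norm (dev (y k) i))\<^sup>2)"
    using N by (simp add: h_def field_simps)
  moreover have "inner ?g (?x - u) \<le> ((norm (?y - u))\<^sup>2 - (norm (?x - u))\<^sup>2) / (2 * \<alpha> k)"
  proof -
    \<comment> \<open>Since \<open>?y - ?x = \<alpha> k *\<^sub>R ?g\<close>, the inner product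
      becomes a difference of squares.\<close>
    have "2 * \<alpha> k * inner ?g (?x - u) = 2 * inner (?y - ?x) (?x - u)"
      by (simp add: average_x_step \<alpha>_def)
    also have "\<dots> = (norm (?y - u))\<^sup>2 - (norm (?x - u))\<^sup>2 - (norm (?y - ?x))\<^sup>2"
      by (simp add: power2_norm_eq_inner inner_diff_left inner_diff_right inner_commute)
    also have "\<dots> \<le> (norm (?y - u))\<^sup>2 - (norm (?x - u))\<^sup>2" by simp
    finally show ?thesis using \<alpha> by (simp add: pos_le_divide_eq mult_ac)
  qed
  moreover have "2 * L * (norm (?x - ?y))\<^sup>2 \<le> 2 * L * (\<alpha> k * G)\<^sup>2"
  proof -
    have "norm ?g \<le> G" using N by (intro norm_average_le norm_grads) auto
    then have "norm (?x - ?y) \<le> \<alpha> k * G"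
      using \<alpha> by (simp add: average_x_step flip: \<alpha>_def)
    then show ?thesis using L_nonneg by (intro mult_left_mono power_mono) auto
  qed
  ultimately show ?thesis by linarith
qed

lemma average_gap:
  assumes \<eta>: "0 \<le> \<eta>" and c: "c > 0" and \<xi>: "0 < \<xi>" "\<xi> < 1" and k: "k \<ge> 1"
  shows "h (average N (x k)) - h xstar
    \<le> 2 / (c * real k) * (R\<^sup>2 + 260 * c * L * (c * G)\<^sup>2 * consensus_constant \<xi> * (1 + ln (real k)))"
proof -
  let ?P = "consensus_constant \<xi>"
  \<comment> \<open>\<open>130 = 128 + 2\<close>: the disagreement contributes
    \<open>2 * 64\<close>, the step length 2, inflated by \<open>?P \<ge> 1\<close>.\<close>
  define E where "E = 130 * L * (c * G)\<^sup>2 * ?P"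
  have P: "1 \<le> ?P" by (rule consensus_constant_ge_1[OF \<xi>])
  have E: "0 \<le> E" using P L_nonneg by (simp add: E_def)
  have N: "real N > 0" using nodes by simp
  have err: "2 * L * (step_size c k * G)\<^sup>2 + 2 * L / real N * (\<Sum>i<N. (norm (dev (y k) i))\<^sup>2)
      \<le> E / (real (k + 1))\<^sup>2" for k
  proof -
    have "2 * L / real N * (\<Sum>i<N. (norm (dev (y k) i))\<^sup>2)
        \<le> 2 * L / real N * (64 * (real N * (c * G)\<^sup>2 * ?P) / (real (k + 1))\<^sup>2)"
      using L_nonneg by (intro mult_left_mono y_disagreement \<eta> c \<xi>) auto
    also have "\<dots> = 128 * L * (c * G)\<^sup>2 * ?P / (real (k + 1))\<^sup>2"
      using N by simp
    finally have 1: "2 * L / real N * (\<Sum>i<N. (norm (dev (y k) i))\<^sup>2) \<le> \<dots>" .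
    have "2 * L * (step_size c k * G)\<^sup>2 = 2 * L * (c * G)\<^sup>2 * 1 / (real (k + 1))\<^sup>2"
      by (simp add: step_size_def power_mult_distrib power_divide)
    also have "\<dots> \<le> 2 * L * (c * G)\<^sup>2 * ?P / (real (k + 1))\<^sup>2"
      using L_nonneg P by (intro divide_right_mono mult_left_mono) auto
    finally have "2 * L * (step_size c k * G)\<^sup>2 \<le> \<dots>" .
    moreover have "2 * L * (c * G)\<^sup>2 * ?P / (real (k + 1))\<^sup>2 + 128 * L * (c * G)\<^sup>2 * ?P / (real (k + 1))\<^sup>2
        = E / (real (k + 1))\<^sup>2"
      by (simp add: E_def flip: add_divide_distrib)
    ultimately show ?thesis using 1 by linarith
  qed
  obtain n where n: "k = Suc n" using k by (cases k) auto
  have "h (average N (x (Suc n))) - h xstar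
      \<le> 2 / (c * real (n + 1)) * ((norm (average N (x 0) - xstar))\<^sup>2 + 2 * c * E * (1 + ln (real (n + 1))))"
  proof (rule inexact_nesterov[where x = "\<lambda>k. average N (x k)" and y = "\<lambda>k. average N (y k)"])
    show "h xstar \<le> h u" if "u \<in> euclid d" for u
      using xstar_le[OF that] by (simp add: h_def divide_right_mono)
    show "h (average N (x (Suc k))) \<le> h u
      + ((norm (average N (y k) - u))\<^sup>2 - (norm (average N (x (Suc k)) - u))\<^sup>2) / (2 * step_size c k)
      + E / (real (k + 1))\<^sup>2" if "u \<in> euclid d" for k u
      using h_step[OF that c, of k] err[of k] by linarith
  qed (fact subspace_euclid xbar_mem xstar_mem convex_h c average_y_0 average_y_step E)+
  also have "\<dots> \<le> 2 / (c * real (n + 1)) * (R\<^sup>2 + 2 * c * E * (1 + ln (real (n + 1))))"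
    using initial_dist c by (intro mult_left_mono add_right_mono power_mono) auto
  finally show ?thesis by (simp add: n E_def algebra_simps)
qed

section \<open>From the average to the nodes\<close>

text \<open>
  Averaging the smoothness bounds at \<open>z + u\<close> and \<open>z - u\<close> cancels the gradient, and the value at
  \<open>z - u\<close> is at least the minimum.
\<close>

lemma gap_perturb:
  assumes z: "z \<in> euclid d" and u: "u \<in> euclid d"
  shows "h (z + u) - h xstar \<le> 2 * (h z - h xstar) + 2 * L * (norm u)\<^sup>2"
proof -
  have N: "real N > 0" using nodes by simp
  note mem = subspace_add[OF subspace_euclid z u] subspace_diff[OF subspace_euclid z u]
  have "f i (z + u) + f i (z - u) \<le> 2 * f i z + 2 * L * (norm u)\<^sup>2" if i: "i < N" for i
    using smooth_upper_bound[OF convex gradient gradient_lipschitz z mem(1), OF i i i]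
      smooth_upper_bound[OF convex gradient gradient_lipschitz z mem(2), OF i i i]
    by simp
  then have "(\<Sum>i<N. f i (z + u) + f i (z - u)) \<le> (\<Sum>i<N. 2 * f i z + 2 * L * (norm u)\<^sup>2)"
    by (intro sum_mono) simp
  then have "objective N f (z + u) + objective N f (z - u)
      \<le> 2 * objective N f z + real N * (2 * L * (norm u)\<^sup>2)"
    by (simp add: objective_def sum.distrib sum_distrib_left)
  then have "objective N f (z + u) + objective N f xstar
      \<le> 2 * objective N f z + real N * (2 * L * (norm u)\<^sup>2)"
    using xstar_le[OF mem(2)] by linarith
  then have "(objective N f (z + u) + objective N f xstar) / real N
      \<le> (2 * objective N f z + real N * (2 * L * (norm u)\<^sup>2)) / real N"
    by (rule divide_right_mono) simp
  then show ?thesis using N by (simp add: h_def add_divide_distrib)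
qed

lemma node_gap:
  assumes \<eta>: "0 \<le> \<eta>" and c: "c > 0" and \<xi>: "0 < \<xi>" "\<xi> < 1" and i: "i < N" and k: "k \<ge> 2"
  shows "1 / real N * (objective N f (x k i) - objective N f xstar)
    \<le> (12 * R\<^sup>2 / c + 3120 * L * (c * G)\<^sup>2 * consensus_constant \<xi>)
      * (ln (real k) / real k + real N / (real k)\<^sup>2)"
proof -
  let ?P = "consensus_constant \<xi>" and ?a = "ln (real k) / real k" and ?b = "real N / (real k)\<^sup>2"
  define M where "M = L * (c * G)\<^sup>2 * ?P"
  have M: "0 \<le> M" using consensus_constant_ge_1[OF \<xi>] L_nonneg by (simp add: M_def)
  \<comment> \<open>For \<open>k \<ge> 2\<close> this gives \<open>1 + ln k \<le> 3 ln k\<close>,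
    the source of the factor 3 below.\<close>
  have ln1: "1 \<le> 2 * ln (real k)"
  proof -
    have "1 / 2 \<le> ln (2::real)" using ln_le_minus_one[of "1 / 2 :: real"] by (simp add: ln_div)
    also have "\<dots> \<le> ln (real k)" using k by simp
    finally show ?thesis by simp
  qed
  have gap: "h (average N (x k)) - h xstar \<le> (6 * R\<^sup>2 / c + 1560 * M) * ?a"
  proof -
    have "h (average N (x k)) - h xstar \<le> 2 / (c * real k) * (R\<^sup>2 + 260 * c * M * (1 + ln (real k)))"
      using average_gap[OF \<eta> c \<xi>, of k] k by (simp add: M_def mult.assoc)
    also have "\<dots> \<le> 2 / (c * real k) * (R\<^sup>2 * (3 * ln (real k)) + 260 * c * M * (3 * ln (real k)))"
    proof (intro mult_left_mono add_mono)
      show "R\<^sup>2 \<le> R\<^sup>2 * (3 * ln (real k))"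
        using ln1 mult_left_mono[of 1 "3 * ln (real k)" "R\<^sup>2"] by simp
    qed (use ln1 c M in auto)
    also have "\<dots> = (6 * R\<^sup>2 / c + 1560 * M) * ?a"
      using c k by (simp add: field_simps)
    finally show ?thesis .
  qed
  have "(norm (dev (x k) i))\<^sup>2 \<le> (\<Sum>i<N. (norm (dev (x k) i))\<^sup>2)"
    using i by (intro member_le_sum) auto
  also have "\<dots> \<le> real N * (c * G)\<^sup>2 * ?P / (real k)\<^sup>2"
    by (rule x_disagreement[OF \<eta> c \<xi>])
  finally have "L * (norm (dev (x k) i))\<^sup>2 \<le> L * (real N * (c * G)\<^sup>2 * ?P / (real k)\<^sup>2)"
    using L_nonneg by (rule mult_left_mono)
  also have "\<dots> = M * ?b" by (simp add: M_def)
  finally have "h (x k i) - h xstar \<le> 2 * ((6 * R\<^sup>2 / c + 1560 * M) * ?a) + 2 * (M * ?b)"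
    using gap_perturb[OF xbar_mem dev_mem[of "x k", OF x_mem i], of k] gap by simp
  also have "\<dots> = (12 * R\<^sup>2 / c + 3120 * M) * ?a + (2 * M) * ?b"
    by (simp add: algebra_simps)
  also have "\<dots> \<le> (12 * R\<^sup>2 / c + 3120 * M) * ?a + (12 * R\<^sup>2 / c + 3120 * M) * ?b"
    using M c k by (intro add_mono mult_right_mono) (simp_all add: algebra_simps)
  finally show ?thesis by (simp add: M_def h_def algebra_simps)
qed

text \<open>Adds the middle term of \<open>rate\<close>, the geometric mean of the outer two and
  hence nonnegative.\<close>

lemma le_rate:
  assumes t: "t \<le> A / (1 - mu N W) powr p * (ln (real k) / real k + real N / (real k)\<^sup>2)"
    and A: "0 \<le> A" and k: "k \<ge> 2"
  shows "t \<le> A * rate p (mu N W) N k"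
proof -
  have "A / (1 - mu N W) powr p * (ln (real k) / real k + real N / (real k)\<^sup>2)
      \<le> A / (1 - mu N W) powr p * (ln (real k) / real k
        + sqrt (real N) * sqrt (ln (real k)) / real k powr (3 / 2) + real N / (real k)\<^sup>2)"
    using A k by (intro mult_left_mono) auto
  then show ?thesis using t by (simp add: rate_def)
qed

end

section \<open>Constants for the two choices of the step size\<close>

theorem theorem6:
  fixes L G R \<eta> \<xi> :: real
  assumes "0 < \<eta>" "\<eta> < 1" "0 < \<xi>" "\<xi> < 1"
  shows
    "(\<forall>c>0. \<exists>C. \<forall>N d H W f g xstar x y.
        dng L G R \<eta> c N d H W f g xstar x y \<longrightarrow>
        (\<forall>i<N. \<forall>k\<ge>2. 1 / real N * (objective N f (x k i) - objective N f xstar)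
                      \<le> C * rate (3 + \<xi>) (mu N W) N k)) \<and>
     (L > 0 \<longrightarrow> (\<exists>C. \<forall>N d H W f g xstar x y.
        dng L G R \<eta> ((1 - mu N W) / (2 * L)) N d H W f g xstar x y \<longrightarrow>
        (\<forall>i<N. \<forall>k\<ge>2. 1 / real N * (objective N f (x k i) - objective N f xstar)
                      \<le> C * rate (1 + \<xi>) (mu N W) N k)))"
proof -
  define K where "K = (1 + 2 / \<xi>)\<^sup>2 * 6 powr (2 + \<xi>)"
  have K: "0 \<le> K" by (simp add: K_def)
  have a: "1 / real N * (objective N f (x k i) - objective N f xstar)
      \<le> (12 * R\<^sup>2 / c + 3120 * L * (c * G)\<^sup>2 * K) * rate (3 + \<xi>) (mu N W) N k"
    if c: "c > 0" and dng: "dng L G R \<eta> c N d H W f g xstar x y" and i: "i < N" and k: "k \<ge> 2"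
    for c N d H W f g xstar x y i k
  proof -
    interpret dng L G R \<eta> c N d H W f g xstar x y by (rule dng)
    define m where "m = (1 - mu N W) powr (3 + \<xi>)"
    have m: "0 < m" "m \<le> 1"
      using mu_nonneg mu_less_1 assms by (auto simp: m_def intro!: powr_le1)
    \<comment> \<open>The disagreement term carries exactly \<open>1 / m\<close>;
      \<open>m \<le> 1\<close> lets the \<open>R\<close> term carry it too.\<close>
    have "12 * R\<^sup>2 / c + 3120 * L * (c * G)\<^sup>2 * consensus_constant \<xi>
        \<le> (12 * R\<^sup>2 / c) / m + 3120 * L * (c * G)\<^sup>2 * K / m"
      using m c divide_left_mono[of m 1 "12 * R\<^sup>2 / c"] by (simp add: consensus_constant_def K_def m_def)
    then have "12 * R\<^sup>2 / c + 3120 * L * (c * G)\<^sup>2 * consensus_constant \<xi>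
        \<le> (12 * R\<^sup>2 / c + 3120 * L * (c * G)\<^sup>2 * K) / m"
      by (simp add: add_divide_distrib)
    then have "(12 * R\<^sup>2 / c + 3120 * L * (c * G)\<^sup>2 * consensus_constant \<xi>)
          * (ln (real k) / real k + real N / (real k)\<^sup>2)
        \<le> (12 * R\<^sup>2 / c + 3120 * L * (c * G)\<^sup>2 * K) / m * (ln (real k) / real k + real N / (real k)\<^sup>2)"
      using k by (intro mult_right_mono) auto
    then show ?thesis
      using node_gap[OF _ c assms(3,4) i k] assms(1) c K L_nonneg k
      by (intro le_rate) (auto simp: m_def)
  qed
  have b: "1 / real N * (objective N f (x k i) - objective N f xstar)
      \<le> (24 * L * R\<^sup>2 + 780 * G\<^sup>2 * K / L) * rate (1 + \<xi>) (mu N W) N k"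
    if L: "L > 0" and dng: "dng L G R \<eta> ((1 - mu N W) / (2 * L)) N d H W f g xstar x y"
      and i: "i < N" and k: "k \<ge> 2"
    for N d H W f g xstar x y i k
  proof -
    interpret dng L G R \<eta> "(1 - mu N W) / (2 * L)" N d H W f g xstar x y by (rule dng)
    define \<delta> where "\<delta> = 1 - mu N W"
    define c where "c = \<delta> / (2 * L)"
    have \<delta>: "0 < \<delta>" "\<delta> \<le> 1" using mu_nonneg mu_less_1 by (auto simp: \<delta>_def)
    have c: "c > 0" using \<delta> L by (simp add: c_def)
    define m where "m = \<delta> powr (1 + \<xi>)"
    have m: "0 < m" using \<delta> by (simp add: m_def)
    have "m \<le> \<delta> powr 1" unfolding m_def using \<delta> assms by (intro powr_mono') auto
    then have md: "m \<le> \<delta>" using \<delta> by simp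
    \<comment> \<open>\<open>1 / c\<close> brings one factor \<open>1 / \<delta>\<close>, which is
      at most \<open>1 / m\<close>.\<close>
    have "12 * R\<^sup>2 / c = 24 * L * R\<^sup>2 / \<delta>" using L by (simp add: c_def)
    also have "\<dots> \<le> 24 * L * R\<^sup>2 / m" using md m L by (intro divide_left_mono) auto
    finally have 1: "12 * R\<^sup>2 / c \<le> 24 * L * R\<^sup>2 / m" .
    \<comment> \<open>Here \<open>c^2\<close> supplies \<open>\<delta>^2 / (4 L^2)\<close>, which
      lowers the exponent from \<open>3 + \<xi>\<close> to \<open>1 + \<xi>\<close> and turns 3120
      into 780.\<close>
    have "\<delta> powr (3 + \<xi>) = \<delta>\<^sup>2 * m"
      using \<delta> powr_add[of \<delta> 2 "1 + \<xi>"] by (simp add: m_def)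
    then have "consensus_constant \<xi> = K / (\<delta>\<^sup>2 * m)"
      by (simp add: consensus_constant_def K_def flip: \<delta>_def)
    then have 2: "3120 * L * (c * G)\<^sup>2 * consensus_constant \<xi> = 780 * G\<^sup>2 * K / L / m"
      using L \<delta> by (simp add: c_def power_mult_distrib power_divide) (simp add: power2_eq_square)
    have "12 * R\<^sup>2 / c + 3120 * L * (c * G)\<^sup>2 * consensus_constant \<xi>
        \<le> (24 * L * R\<^sup>2 + 780 * G\<^sup>2 * K / L) / m"
      using 1 2 by (simp add: add_divide_distrib)
    then have "(12 * R\<^sup>2 / c + 3120 * L * (c * G)\<^sup>2 * consensus_constant \<xi>)
          * (ln (real k) / real k + real N / (real k)\<^sup>2)
        \<le> (24 * L * R\<^sup>2 + 780 * G\<^sup>2 * K / L) / m * (ln (real k) / real k + real N / (real k)\<^sup>2)"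
      using k by (intro mult_right_mono) auto
    then show ?thesis
      using node_gap[OF _ _ assms(3,4) i k] assms(1) c K L k
      by (intro le_rate) (auto simp: m_def c_def \<delta>_def)
  qed
  show ?thesis
  proof (intro conjI allI impI)
    fix c :: real assume c: "c > 0"
    show "\<exists>C. \<forall>N d H W f g xstar x y. dng L G R \<eta> c N d H W f g xstar x y \<longrightarrow>
        (\<forall>i<N. \<forall>k\<ge>2. 1 / real N * (objective N f (x k i) - objective N f xstar)
                      \<le> C * rate (3 + \<xi>) (mu N W) N k)"
      by (intro exI allI impI) (erule (2) a[OF c])
  next
    assume L: "L > 0"
    show "\<exists>C. \<forall>N d H W f g xstar x y. dng L G R \<eta> ((1 - mu N W) / (2 * L)) N d H W f g xstar x y \<longrightarrow>
        (\<forall>i<N. \<forall>k\<ge>2. 1 / real N * (objective N f (x k i) - objective N f xstar)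
                      \<le> C * rate (1 + \<xi>) (mu N W) N k)"
      by (intro exI allI impI) (erule (2) b[OF L])
  qed
qed

end
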